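(* Let $0<\underline\gamma<\gamma\le\overline\gamma$ and let $0<2\alpha<\beta<1$. Let $K$ be a kernel for which there exists $C_K<\infty$ such that $K(y,x)=0$ for $|x-y|>C_K$ and such that $K(y,x)=K(y-k,x-k)$ for all $k\in\mathbb{Z}$ and $x,y\in\mathbb{R}$. Then there exist $C_{K,\overline\gamma,*}>0$, $\underline j_{K,\overline\gamma}$ and $\eta_{K,\overline\gamma}>0$, depending only on $K$ and $\overline\gamma$, such that, for all integers $\underline\ell\ge\underline j_{K,\overline\gamma}$ and all $0<\varepsilon\le\varepsilon'<\eta_{K,\overline\gamma}$, $$R^*_{n,\alpha,\beta}\Big(\mathcal{F}_{\text{self-sim}}(\gamma,1,\varepsilon';K,\underline\ell),\ \bigcup_{\gamma'\in[\underline\gamma,\overline\gamma]}\mathcal{F}_{\text{self-sim}}(\gamma',1,\varepsilon;K,\underline\ell)\Big)\ \ge\ (1+o(1))\,C_{K,\overline\gamma,*}\,\varepsilon^{-1/(2\gamma+1)}\left(\sigma_n^2\log(1/\sigma_n)\right)^{\gamma/(2\gamma+1)},$$ where $o(1)$ denotes a term tending to $0$ as $n\to\infty$ with all other quantities held fixed.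
   Context: White noise model: one observes $Y(t)=\int_0^t f(s)\,ds+\sigma_n W(t)$ for $t\in[-\eta,1+\eta]$ (some fixed $\eta>0$), where $f:\mathbb{R}\to\mathbb{R}$ is unknown, $W$ is a standard (two-sided) Brownian motion, and $\sigma_n=\sigma/\sqrt n$ is known, with $\sigma>0$ fixed. $P_f$ denotes probability when $Y$ is generated by $f$. H\"older class: for $\gamma,B>0$, with $\lfloor\gamma\rfloor$ the greatest integer strictly less than $\gamma$, $\mathcal{F}_{\text{H\"ol}}(\gamma,B)$ is the set of ($\lfloor\gamma\rfloor$ times differentiable) $f:\mathbb{R}\to\mathbb{R}$ with $|f^{(\lfloor\gamma\rfloor)}(t)-f^{(\lfloor\gamma\rfloor)}(t')|\le B|t-t'|^{\gamma-\lfloor\gamma\rfloor}$ for all $t,t'\in\mathbb{R}$. Kernel: a function $K:\mathbb{R}^2\to\mathbb{R}$ such that $x\mapsto K(t,x)$ is of bounded variation for each $t$. For an integer $j$, $K_j(t,x)=2^jK(2^jt,2^jx)$ and $K_jf(t)=\int K_j(t,x)f(x)\,dx$. Self-similarity class: for $\gamma,B,\varepsilon>0$ and integer $\underline\ell$, $\mathcal{F}_{\text{self-sim}}(\gamma,B,\varepsilon;K,\underline\ell)$ is the set of $f\in\mathcal{F}_{\text{H\"ol}}(\gamma,B)$ such that $\sup_{t\in[0,1]}|K_jf(t)-f(t)|\ge\varepsilon B2^{-j\gamma}$ for all integers $j\ge\underline\ell$. Confidence bands: a confidence band $\mathcal{C}_n(\cdot)$ is a collection of random intervals $\mathcal{C}_n(x)=\mathcal{C}_n(x;Y)$,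 $x\in[0,1]$, depending on the data $Y$ at noise level $\sigma_n$. $\mathcal{I}_{n,\alpha,\mathcal{F}}$ is the set of confidence bands with $\inf_{f\in\mathcal{F}}P_f(f(x)\in\mathcal{C}_n(x)\text{ for all }x\in[0,1])\ge1-\alpha$. With $\mathrm{length}(\mathcal{A})=\sup\mathcal{A}-\inf\mathcal{A}$ and $q_{\beta,f}$ the $\beta$ quantile under $P_f$, let $R_\beta(\mathcal{C}_n;\mathcal{G})=\sup_{f\in\mathcal{G}}q_{\beta,f}\big(\sup_{x\in[0,1]}\mathrm{length}(\mathcal{C}_n(x))\big)$, and $R^*_{n,\alpha,\beta}(\mathcal{G},\mathcal{F})=\inf_{\mathcal{C}_n(\cdot)\in\mathcal{I}_{n,\alpha,\mathcal{F}}}R_\beta(\mathcal{C}_n;\mathcal{G})$. *)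

theory Defs
  imports "HOL-Probability.Probability"
begin

section \<open>Function classes\<close>

text \<open>For \<open>\<gamma> > 0\<close>, the greatest integer strictly less than \<open>\<gamma>\<close>; so \<open>holder_floor 1 = 0\<close>.\<close>

definition holder_floor :: "real \<Rightarrow> nat" where
  "holder_floor \<gamma> = nat (\<lceil>\<gamma>\<rceil> - 1)"

definition holder_class :: "real \<Rightarrow> real \<Rightarrow> (real \<Rightarrow> real) set" where
  "holder_class \<gamma> B =
    {f. (\<forall>k < holder_floor \<gamma>. \<forall>t. (deriv ^^ k) f differentiable (at t)) \<and>
        (\<forall>t t'. \<bar>(deriv ^^ holder_floor \<gamma>) f t - (deriv ^^ holder_floor \<gamma>) f t'\<bar>
                  \<le> B * \<bar>t - t'\<bar> powr (\<gamma> - real (holder_floor \<gamma>)))}"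

definition bounded_variation_line :: "(real \<Rightarrow> real) \<Rightarrow> bool" where
  "bounded_variation_line g \<longleftrightarrow>
    (\<exists>V. \<forall>ts :: nat \<Rightarrow> real. mono ts \<longrightarrow> (\<forall>m. (\<Sum>i<m. \<bar>g (ts (Suc i)) - g (ts i)\<bar>) \<le> V))"

definition bv_kernel :: "(real \<Rightarrow> real \<Rightarrow> real) \<Rightarrow> bool" where
  "bv_kernel K \<longleftrightarrow> (\<forall>t. bounded_variation_line (\<lambda>x. K t x))"

definition kernel_scale :: "(real \<Rightarrow> real \<Rightarrow> real) \<Rightarrow> int \<Rightarrow> real \<Rightarrow> real \<Rightarrow> real" where
  "kernel_scale K j t x = 2 powi j * K (2 powi j * t) (2 powi j * x)"

definition kernel_op :: "(real \<Rightarrow> real \<Rightarrow> real) \<Rightarrow> int \<Rightarrow> (real \<Rightarrow> real) \<Rightarrow> real \<Rightarrow> real" where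
  "kernel_op K j f t = (LINT x|lborel. kernel_scale K j t x * f x)"

text \<open>The supremum is taken in the extended reals: a kernel is not assumed to be bounded in its
  first argument, so the approximation error may be unbounded over \<open>t \<in> [0,1]\<close>.\<close>

definition self_sim_class ::
  "real \<Rightarrow> real \<Rightarrow> real \<Rightarrow> (real \<Rightarrow> real \<Rightarrow> real) \<Rightarrow> int \<Rightarrow> (real \<Rightarrow> real) set" where
  "self_sim_class \<gamma> B \<epsilon> K l =
    {f \<in> holder_class \<gamma> B.
      \<forall>j::int. j \<ge> l \<longrightarrow>
        (SUP t\<in>{0..1}. ereal \<bar>kernel_op K j f t - f t\<bar>) \<ge> ereal (\<epsilon> * B * 2 powr (- (real_of_int j * \<gamma>)))}"

section \<open>The white noise model\<close>

text \<open>Requiring independent, centred Gaussian increments along every increasing sequence of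
  \<^emph>\<open>real\<close> times, together with \<open>W 0 = 0\<close>, makes \<open>(W t)\<close> and \<open>(W (-t))\<close>, \<open>t \<ge> 0\<close>, two independent
  one-sided standard Brownian motions.\<close>

definition two_sided_brownian_motion :: "'a measure \<Rightarrow> (real \<Rightarrow> 'a \<Rightarrow> real) \<Rightarrow> bool" where
  "two_sided_brownian_motion M W \<longleftrightarrow>
     prob_space M \<and>
     (\<forall>t. W t \<in> borel_measurable M) \<and>
     (\<forall>\<omega>\<in>space M. W 0 \<omega> = 0) \<and>
     (\<forall>\<omega>\<in>space M. continuous_on UNIV (\<lambda>t. W t \<omega>)) \<and>
     (\<forall>s t. s < t \<longrightarrow>
        distributed M lborel (\<lambda>\<omega>. W t \<omega> - W s \<omega>) (\<lambda>x. ennreal (normal_density 0 (sqrt (t - s)) x))) \<and>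
     (\<forall>ts :: nat \<Rightarrow> real. strict_mono ts \<longrightarrow>
        prob_space.indep_vars M (\<lambda>_. borel) (\<lambda>i \<omega>. W (ts (Suc i)) \<omega> - W (ts i) \<omega>) UNIV)"

text \<open>The sample space of the data: continuous paths on \<open>[-h, 1+h]\<close> (extended by \<open>undefined\<close> outside
  that interval) with the \<open>\<sigma>\<close>-algebra generated by the coordinates.\<close>

definition path_space :: "real \<Rightarrow> (real \<Rightarrow> real) measure" where
  "path_space h =
     restrict_space (\<Pi>\<^sub>M t\<in>{-h..1+h}. borel) {y. continuous_on {-h..1+h} y}"

text \<open>The interval integral is signed, so that it is \<open>-\<integral>\<^sub>t\<^sup>0 f\<close> for negative \<open>t\<close>.\<close>

definition observation ::
  "(real \<Rightarrow> 'a \<Rightarrow> real) \<Rightarrow> real \<Rightarrow> real \<Rightarrow> (real \<Rightarrow> real) \<Rightarrow> 'a \<Rightarrow> real \<Rightarrow> real" where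
  "observation W h s f \<omega> = (\<lambda>t\<in>{-h..1+h}. (LBINT u=0..t. f u) + s * W t \<omega>)"

definition data_law ::
  "'a measure \<Rightarrow> (real \<Rightarrow> 'a \<Rightarrow> real) \<Rightarrow> real \<Rightarrow> real \<Rightarrow> (real \<Rightarrow> real) \<Rightarrow> (real \<Rightarrow> real) measure" where
  "data_law M W h s f = distr M (path_space h) (observation W h s f)"

section \<open>Confidence bands\<close>

text \<open>For nonempty \<open>A\<close> this is \<open>sup A - inf A\<close>, possibly infinite. A band is allowed to contain an empty
  interval, whose length is \<open>0\<close> by convention.\<close>

definition interval_length :: "real set \<Rightarrow> ereal" where
  "interval_length A = (if A = {} then 0 else (SUP z\<in>A. ereal z) - (INF z\<in>A. ereal z))"

type_synonym band = "(real \<Rightarrow> real) \<Rightarrow> real \<Rightarrow> real set"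

definition max_length :: "band \<Rightarrow> (real \<Rightarrow> real) \<Rightarrow> ereal" where
  "max_length C y = (SUP x\<in>{0..1}. interval_length (C y x))"

definition coverage_event :: "real \<Rightarrow> band \<Rightarrow> (real \<Rightarrow> real) \<Rightarrow> (real \<Rightarrow> real) set" where
  "coverage_event h C f = {y \<in> space (path_space h). \<forall>x\<in>{0..1}. f x \<in> C y x}"

text \<open>Of the measurability of a band in the data, only what is needed to give meaning to the coverage
  probabilities over \<open>F\<close> and to the quantiles of the maximal length is required.\<close>

definition confidence_band :: "real \<Rightarrow> (real \<Rightarrow> real) set \<Rightarrow> band \<Rightarrow> bool" where
  "confidence_band h F C \<longleftrightarrow>
     (\<forall>y\<in>space (path_space h). \<forall>x\<in>{0..1}. is_interval (C y x)) \<and>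
     max_length C \<in> borel_measurable (path_space h) \<and>
     (\<forall>f\<in>F. coverage_event h C f \<in> sets (path_space h))"

text \<open>In the following, \<open>P f\<close> is the law of the data when the regression function is \<open>f\<close>.\<close>

definition covering_bands ::
  "((real \<Rightarrow> real) \<Rightarrow> (real \<Rightarrow> real) measure) \<Rightarrow> real \<Rightarrow> real \<Rightarrow> (real \<Rightarrow> real) set \<Rightarrow> band set" where
  "covering_bands P h \<alpha> F =
     {C. confidence_band h F C \<and>
         (INF f\<in>F. ereal (measure (P f) (coverage_event h C f))) \<ge> ereal (1 - \<alpha>)}"

definition quantile :: "'b measure \<Rightarrow> real \<Rightarrow> ('b \<Rightarrow> ereal) \<Rightarrow> ereal" where
  "quantile Q \<beta> L = Inf {q. measure Q {y \<in> space Q. L y \<le> q} \<ge> \<beta>}"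

definition band_risk ::
  "((real \<Rightarrow> real) \<Rightarrow> (real \<Rightarrow> real) measure) \<Rightarrow> real \<Rightarrow> band \<Rightarrow> (real \<Rightarrow> real) set \<Rightarrow> ereal" where
  "band_risk P \<beta> C G = (SUP f\<in>G. quantile (P f) \<beta> (max_length C))"

definition minimax_length ::
  "((real \<Rightarrow> real) \<Rightarrow> (real \<Rightarrow> real) measure) \<Rightarrow> real \<Rightarrow> real \<Rightarrow> real \<Rightarrow>
    (real \<Rightarrow> real) set \<Rightarrow> (real \<Rightarrow> real) set \<Rightarrow> ereal" where
  "minimax_length P h \<alpha> \<beta> G F = (INF C\<in>covering_bands P h \<alpha> F. band_risk P \<beta> C G)"

definition noise_level :: "real \<Rightarrow> nat \<Rightarrow> real" where
  "noise_level \<sigma> n = \<sigma> / sqrt (real n)"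

end

theory Submission
  imports Defs
begin

text \<open>A base function \<open>f\<close>, self-similar of order \<open>\<gamma>\<close> with a constant depending only on \<open>K\<close> and the
  largest smoothness, is perturbed by one of about \<open>2\<^sup>i\<close> disjoint spikes of width \<open>2\<^bsup>-i\<^esup>\<close>. A spike only has
  to be smooth of some order \<open>\<gamma>' < \<gamma>\<close>: if \<open>\<gamma> - \<gamma>'\<close> is of order \<open>log (1/\<epsilon>) / i\<close>, then it can be higher by a
  factor of order \<open>1/\<epsilon>\<close> than a spike of order \<open>\<gamma>\<close>, while the bias of \<open>f\<close> still exceeds \<open>\<epsilon> 2\<^bsup>-j\<gamma>'\<^esup>\<close> at all
  levels \<open>j < i\<close>. At the levels \<open>j \<ge> i\<close> the bias is provided by the spike itself, which carries a lacunary
  tail of ever finer bumps. By a second moment computation the uniform mixture over the spikes cannot be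
  told apart from \<open>f\<close> as long as the squared norm of a spike is a small multiple of
  \<open>\<sigma>\<^sub>n\<^sup>2 log (1/\<sigma>\<^sub>n)\<close>, whereas a band shorter than the height of the spikes would separate them.\<close>

section \<open>Lacunary series of bumps\<close>

text \<open>Self-similarity asks for a bias bound at every level, for a kernel that need not be
  regular or even bounded in its first argument. The bias is therefore tested only at points t with
  2^j t an integer, where periodicity turns K into a translate of the single bounded function
  \<open>K 0\<close>, and every level j gets its own bump centred at such a point. The bump is so
  narrow, compared with a bound of \<open>K 0\<close>, that averaging keeps at most half of its
  height. No other bump may enter the range C / 2^j of the kernel there, which is why the centres
  lie at distance A / 2^j with A = 4 C. The logarithm in the rate is the entropy of the spike
  positions: at noise level t there are at least a constant times t^(-2 \<kappa>) spikes, so the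
  second moment of the likelihood ratio of one spike may grow like t^(-\<kappa>), an exponent
  proportional to log (1/t). Path laws are compared without Girsanov's theorem: on cylinder sets
  only Gaussian vectors of increments matter, the bound is the same for all cylinders, and cylinders
  approximate every measurable set.\<close>

lemma DERIV_max_0_power:
  fixes x :: real
  assumes "n \<ge> 1"
  shows "((\<lambda>y. max 0 y ^ Suc n) has_real_derivative real (Suc n) * max 0 x ^ n) (at x)"
proof -
  consider "x > 0" | "x < 0" | "x = 0" by linarith
  then show ?thesis
  proof cases
    case 1
    have "((\<lambda>y. y ^ Suc n) has_real_derivative real (Suc n) * x ^ n) (at x)"
      using DERIV_pow[of "Suc n" x UNIV] by simp
    then have "((\<lambda>y. max 0 y ^ Suc n) has_real_derivative real (Suc n) * x ^ n) (at x)"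
      by (rule has_field_derivative_transform_within_open[where S = "{0<..}"]) (use 1 in auto)
    then show ?thesis using 1 by simp
  next
    case 2
    have "((\<lambda>y. 0) has_real_derivative 0) (at x)" by simp
    then have "((\<lambda>y. max 0 y ^ Suc n) has_real_derivative 0) (at x)"
      by (rule has_field_derivative_transform_within_open[where S = "{..<0}"]) (use 2 in auto)
    then show ?thesis using 2 assms by (simp add: power_0_left)
  next
    case 3
    have "((\<lambda>h::real. \<bar>h\<bar> ^ n) \<longlongrightarrow> \<bar>0\<bar> ^ n) (at 0)"
      by (intro tendsto_intros)
    then have lim: "((\<lambda>h::real. \<bar>h\<bar> ^ n) \<longlongrightarrow> 0) (at 0)"
      using assms by (simp add: power_0_left)
    have "((\<lambda>h::real. (max 0 h ^ Suc n) / h) \<longlongrightarrow> 0) (at 0)"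
    proof (rule Lim_null_comparison[OF _ lim])
      show "\<forall>\<^sub>F h::real in at 0. norm (max 0 h ^ Suc n / h) \<le> \<bar>h\<bar> ^ n"
        by (rule always_eventually) (auto simp: max_def abs_mult)
    qed
    then show ?thesis
      using 3 assms by (simp add: DERIV_def power_0_left)
  qed
qed

text \<open>The witness is max 0 (s^2 - x^2) to the power N + 2, normalised at 0. Each
  differentiation lowers the power by one and changes a polynomial factor, so N derivatives stay
  explicit and still vanish at the edge of the support.\<close>

lemma smooth_bump_exists:
  fixes s :: real
  assumes "s > 0"
  shows "\<exists>(\<psi> :: nat \<Rightarrow> real \<Rightarrow> real) D. D \<ge> 1 \<and> (\<forall>k\<le>N. \<forall>x. \<bar>\<psi> k x\<bar> \<le> D) \<and>
    (\<forall>k<N. \<forall>x. (\<psi> k has_real_derivative \<psi> (Suc k) x) (at x)) \<and>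
    (\<forall>k\<le>N. \<forall>x. s \<le> \<bar>x\<bar> \<longrightarrow> \<psi> k x = 0) \<and> \<psi> 0 0 = 1 \<and> (\<forall>x. 0 \<le> \<psi> 0 x \<and> \<psi> 0 x \<le> 1)"
proof -
  define M where "M = N + 2"
  define u where "u x = max 0 (s\<^sup>2 - x\<^sup>2)" for x :: real
  \<comment> \<open>The recursion is (p u^m)' = (p' u + m p u') u^(m-1) with u = s^2 - x^2 and u' =
    -2 x.\<close>
  define q :: "nat \<Rightarrow> real poly" where
    "q = rec_nat [:1 / s ^ (2 * M):]
           (\<lambda>k p. pderiv p * [:s\<^sup>2, 0, -1:] + smult (real (M - k)) (p * [:0, -2:]))"
  have q0: "q 0 = [:1 / s ^ (2 * M):]"
    and qS: "\<And>k. q (Suc k) = pderiv (q k) * [:s\<^sup>2, 0, -1:] + smult (real (M - k)) (q k * [:0, -2:])"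
    by (simp_all add: q_def)
  define \<psi> where "\<psi> k x = poly (q k) x * u x ^ (M - k)" for k x
  have deriv: "(\<psi> k has_real_derivative \<psi> (Suc k) x) (at x)" if "k < N" for k x
  proof -
    obtain n where n: "M - k = Suc n" "n \<ge> 1" "M - Suc k = n"
    proof
      show "M - k = Suc (M - k - 1)" "1 \<le> M - k - 1" "M - Suc k = M - k - 1"
        using \<open>k < N\<close> by (auto simp: M_def)
    qed
    have "((\<lambda>x. s\<^sup>2 - x\<^sup>2) has_real_derivative - 2 * x) (at x)"
      by (auto intro!: derivative_eq_intros)
    from DERIV_chain2[OF DERIV_max_0_power[OF n(2)] this]
    have du: "((\<lambda>x. u x ^ Suc n) has_real_derivative real (Suc n) * u x ^ n * (- 2 * x)) (at x)"
      by (simp add: u_def)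
    have e: "u x ^ Suc n = (s\<^sup>2 - x\<^sup>2) * u x ^ n"
      using n(2) by (auto simp: u_def max_def power_0_left)
    have "poly (pderiv (q k)) x * u x ^ Suc n + real (Suc n) * u x ^ n * (- 2 * x) * poly (q k) x =
        poly (q (Suc k)) x * u x ^ n"
      unfolding qS n(1) e by (simp add: algebra_simps power2_eq_square)
    with DERIV_mult[OF poly_DERIV[of "q k" x] du] show ?thesis
      unfolding \<psi>_def[abs_def] n(1) n(3) by (rule DERIV_cong)
  qed
  have zero: "\<psi> k x = 0" if "k \<le> N" "s \<le> \<bar>x\<bar>" for k x
  proof -
    have "s\<^sup>2 \<le> x\<^sup>2" using that(2) assms by (simp add: abs_le_square_iff[symmetric])
    then show ?thesis using that(1) by (simp add: \<psi>_def u_def M_def)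
  qed
  have "\<exists>B. \<forall>x. \<bar>\<psi> k x\<bar> \<le> B" if "k \<le> N" for k
  proof -
    have "continuous_on {-s..s} (\<psi> k)"
      unfolding \<psi>_def[abs_def] u_def by (intro continuous_intros)
    then have "bounded (\<psi> k ` {-s..s})"
      by (intro compact_imp_bounded compact_continuous_image) auto
    then obtain B where B: "\<And>x. x \<in> {-s..s} \<Longrightarrow> \<bar>\<psi> k x\<bar> \<le> B"
      unfolding bounded_iff by (metis imageI real_norm_def)
    have "\<bar>\<psi> k x\<bar> \<le> max B 0" for x
    proof (cases "\<bar>x\<bar> < s")
      case True
      then have "x \<in> {-s..s}" by auto
      from B[OF this] show ?thesis by simp
    qed (use zero[OF that, of x] in auto)
    then show ?thesis by blast
  qed
  then obtain B where B: "\<And>k x. k \<le> N \<Longrightarrow> \<bar>\<psi> k x\<bar> \<le> B k" by metis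
  have "\<bar>\<psi> k x\<bar> \<le> Max (insert 1 (B ` {..N}))" if "k \<le> N" for k x
    using B[OF that, of x] that by (intro order_trans[OF _ Max_ge]) auto
  moreover have "1 \<le> Max (insert 1 (B ` {..N}))" by (intro Max_ge) auto
  moreover have "\<psi> 0 0 = 1"
    using assms by (simp add: \<psi>_def q0 u_def max_def power_mult)
  moreover have "0 \<le> \<psi> 0 x \<and> \<psi> 0 x \<le> 1" for x
  proof -
    have "0 \<le> u x" "u x \<le> s\<^sup>2" by (auto simp: u_def)
    then have "u x ^ M \<le> (s\<^sup>2) ^ M" "0 \<le> u x ^ M" by (auto intro: power_mono)
    then show ?thesis using assms by (simp add: \<psi>_def q0 power_mult divide_simps)
  qed
  ultimately show ?thesis using deriv zero by blast
qed

lemma two_powr_nat: "(2::real) ^ j = 2 powr real j"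
  by (simp add: powr_realpow)

text \<open>Level j carries a bump of half-width s / 2^j centred at q + A / 2^j, so the bumps
  accumulate at q from the right. C is the range of the kernel: the window of radius C / 2^j about
  the centre reaches from 3 C / 2^j to 5 C / 2^j beyond q and ends before the next coarser one
  starts at 6 C / 2^j.\<close>

locale lacunary_bump =
  fixes \<psi> :: "nat \<Rightarrow> real \<Rightarrow> real" and D s :: real and N A C :: nat
  assumes D: "D \<ge> 1" and s: "0 < s" "s \<le> 1" and C: "C \<ge> 1" and A: "A = 4 * C"
    and \<psi>_bound: "\<And>k x. k \<le> N \<Longrightarrow> \<bar>\<psi> k x\<bar> \<le> D"
    and \<psi>_deriv: "\<And>k x. k < N \<Longrightarrow> (\<psi> k has_real_derivative \<psi> (Suc k) x) (at x)"
    and \<psi>_zero: "\<And>k x. k \<le> N \<Longrightarrow> s \<le> \<bar>x\<bar> \<Longrightarrow> \<psi> k x = 0"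
    and \<psi>_centre: "\<psi> 0 0 = 1"
    and \<psi>_range: "\<And>x. 0 \<le> \<psi> 0 x" "\<And>x. \<psi> 0 x \<le> 1"
begin

text \<open>\<open>k\<close> counts derivatives: each one brings out a factor 2^j, while the
  coefficients \<open>a\<close> stay the same.\<close>

definition atom :: "nat \<Rightarrow> (nat \<Rightarrow> real) \<Rightarrow> real \<Rightarrow> nat \<Rightarrow> real \<Rightarrow> real" where
  "atom k a q j x = a j * 2 ^ (j * k) * \<psi> k (2 ^ j * (x - q) - real A)"

definition lac :: "nat \<Rightarrow> (nat \<Rightarrow> real) \<Rightarrow> real \<Rightarrow> real \<Rightarrow> real" where
  "lac k a q x = (\<Sum>j. atom k a q j x)"

text \<open>Both scaled distances lie between 3 C and 5 C, so doubling one of them overshoots the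
  other. The first bound is the range of the kernel, the second contains the support of an atom;
  hence atoms are separated from each other and from the kernel windows of other levels.\<close>

lemma dyadic_window_disjoint:
  fixes y :: real
  assumes "\<bar>2 ^ j * y - real A\<bar> \<le> real C" "\<bar>2 ^ i * y - real A\<bar> < 1"
  shows "i = j"
proof (rule ccontr)
  assume "i \<noteq> j"
  have C1: "real C \<ge> 1" using C by simp
  have A4: "real A = 4 * real C" using A by simp
  from \<open>i \<noteq> j\<close> consider "j < i" | "i < j" by linarith
  then show False
  proof cases
    case 1
    then obtain l where l: "i = j + Suc l" by (metis add_Suc_right less_imp_Suc_add)
    have ge: "2 ^ j * y \<ge> 3 * real C" using assms(1) A4 by linarith
    have "2 ^ i * y = 2 ^ Suc l * (2 ^ j * y)" by (simp add: l power_add)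
    moreover have "(2::real) ^ Suc l \<ge> 2" by simp
    ultimately have "2 ^ i * y \<ge> 2 * (3 * real C)"
      using mult_mono[of 2 "2 ^ Suc l" "3 * real C" "2 ^ j * y"] ge C1 by linarith
    then show False using assms(2) A4 C1 by linarith
  next
    case 2
    then obtain l where l: "j = i + Suc l" by (metis add_Suc_right less_imp_Suc_add)
    have le: "2 ^ j * y \<le> 5 * real C" using assms(1) A4 by linarith
    have gt: "2 ^ i * y > 3 * real C" using assms(2) A4 C1 by linarith
    have "2 ^ j * y = 2 ^ Suc l * (2 ^ i * y)" by (simp add: l power_add)
    moreover have "(2::real) ^ Suc l \<ge> 2" by simp
    ultimately have "2 ^ j * y \<ge> 2 * (3 * real C)"
      using mult_mono[of 2 "2 ^ Suc l" "3 * real C" "2 ^ i * y"] gt C1 by linarith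
    then show False using le C1 by linarith
  qed
qed

lemma atom_nonzeroD:
  assumes "k \<le> N" "atom k a q j x \<noteq> 0"
  shows "\<bar>2 ^ j * (x - q) - real A\<bar> < s" "a j \<noteq> 0"
  using assms \<psi>_zero[OF assms(1), of "2 ^ j * (x - q) - real A"] by (force simp: atom_def)+

lemma atom_nonzero_unique:
  assumes "k \<le> N" "atom k a q i x \<noteq> 0" "atom k a q j x \<noteq> 0"
  shows "i = j"
proof (rule dyadic_window_disjoint)
  show "\<bar>2 ^ j * (x - q) - real A\<bar> \<le> real C" "\<bar>2 ^ i * (x - q) - real A\<bar> < 1"
    using atom_nonzeroD(1)[OF assms(1,2)] atom_nonzeroD(1)[OF assms(1,3)] s C by simp_all
qed

lemma lac_eq_atom:
  assumes "\<And>i. i \<noteq> j \<Longrightarrow> atom k a q i x = 0"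
  shows "lac k a q x = atom k a q j x"
  unfolding lac_def using suminf_finite[of "{j}" "\<lambda>j. atom k a q j x"] assms by auto

lemma lac_cases:
  assumes "k \<le> N"
  obtains j where "lac k a q x = atom k a q j x" "\<And>i. i \<noteq> j \<Longrightarrow> atom k a q i x = 0"
proof (cases "\<exists>j. atom k a q j x \<noteq> 0")
  case True
  then obtain j where "atom k a q j x \<noteq> 0" by blast
  then have "\<And>i. i \<noteq> j \<Longrightarrow> atom k a q i x = 0" using atom_nonzero_unique[OF assms] by blast
  then show ?thesis using that lac_eq_atom by blast
next
  case False
  then show ?thesis using that[of 0] lac_eq_atom[of 0] by blast
qed

lemma atom_bound:
  assumes a: "\<And>j. \<bar>a j\<bar> \<le> c * 2 powr (- (real j * \<gamma>))" and "k \<le> N"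
  shows "\<bar>atom k a q j x\<bar> \<le> c * D * (2 powr (- (\<gamma> - real k))) ^ j"
proof -
  have "\<bar>atom k a q j x\<bar> = \<bar>a j\<bar> * 2 ^ (j * k) * \<bar>\<psi> k (2 ^ j * (x - q) - real A)\<bar>"
    by (simp add: atom_def abs_mult)
  also have "\<dots> \<le> (c * 2 powr (- (real j * \<gamma>))) * 2 ^ (j * k) * D"
    using D order_trans[OF abs_ge_zero a[of j]] by (intro mult_mono a \<psi>_bound assms) auto
  also have "\<dots> = c * D * (2 powr (- (real j * \<gamma>)) * 2 ^ (j * k))" by (simp add: mult_ac)
  also have "2 powr (- (real j * \<gamma>)) * 2 ^ (j * k) = (2 powr (- (\<gamma> - real k))) ^ j"
  proof -
    have "(2::real) powr (- (real j * \<gamma>)) * 2 ^ (j * k) = 2 powr (- (real j * \<gamma>) + real (j * k))"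
      unfolding powr_add by (simp only: two_powr_nat)
    also have "- (real j * \<gamma>) + real (j * k) = (- (\<gamma> - real k)) * real j" by (simp add: algebra_simps)
    also have "2 powr \<dots> = (2 powr (- (\<gamma> - real k))) ^ j" by (simp add: powr_powr[symmetric] powr_realpow)
    finally show ?thesis .
  qed
  finally show ?thesis .
qed

lemma summable_atom_bound:
  assumes "real k < \<gamma>"
  shows "summable (\<lambda>j. c * D * (2 powr (- (\<gamma> - real k))) ^ j)"
proof -
  have "2 powr (- (\<gamma> - real k)) < 2 powr (0::real)" using assms by (intro powr_less_mono) auto
  then show ?thesis by (intro summable_mult summable_geometric) auto
qed

lemma lac_uniform_limit:
  assumes a: "\<And>j. \<bar>a j\<bar> \<le> c * 2 powr (- (real j * \<gamma>))" and "k \<le> N" "real k < \<gamma>"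
  shows "uniform_limit UNIV (\<lambda>n x. \<Sum>j<n. atom k a q j x) (lac k a q) sequentially"
  unfolding lac_def[abs_def]
  by (rule Weierstrass_m_test[OF _ summable_atom_bound[OF assms(3)]])
     (use atom_bound[OF a assms(2)] in auto)

lemma continuous_on_lac:
  assumes a: "\<And>j. \<bar>a j\<bar> \<le> c * 2 powr (- (real j * \<gamma>))" and "0 < \<gamma>" "0 < N"
  shows "continuous_on UNIV (lac 0 a q)"
proof (rule uniform_limit_theorem)
  have "continuous_on UNIV (\<psi> 0)"
    using \<psi>_deriv[OF assms(3)] by (meson DERIV_isCont continuous_at_imp_continuous_on)
  then have "continuous_on UNIV (\<lambda>x. \<psi> 0 (2 ^ j * (x - q) - real A))" for j
    by (rule continuous_on_compose2) (auto intro!: continuous_intros)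
  then show "\<forall>\<^sub>F n in sequentially. continuous_on UNIV (\<lambda>x. \<Sum>j<n. atom 0 a q j x)"
    unfolding atom_def by (intro always_eventually allI continuous_intros)
  show "uniform_limit UNIV (\<lambda>n x. \<Sum>j<n. atom 0 a q j x) (lac 0 a q) sequentially"
    using lac_uniform_limit[OF a] assms by simp
qed auto

text \<open>Differentiation term by term is justified while k + 1 < \<gamma>: the differentiated
  series then has a geometric majorant of ratio 2^(k + 1 - \<gamma>).\<close>

lemma DERIV_lac:
  assumes a: "\<And>j. \<bar>a j\<bar> \<le> c * 2 powr (- (real j * \<gamma>))" and "Suc k \<le> N" "real (Suc k) < \<gamma>"
  shows "(lac k a q has_real_derivative lac (Suc k) a q x) (at x)"
  unfolding lac_def[abs_def]
proof (rule has_field_derivative_series'(2)[where S = UNIV and ?x0.0 = x])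
  fix j y
  have "((\<lambda>x. \<psi> k (2 ^ j * (x - q) - real A)) has_real_derivative
        \<psi> (Suc k) (2 ^ j * (y - q) - real A) * 2 ^ j) (at y)"
    by (rule DERIV_chain2[OF \<psi>_deriv]) (use assms in \<open>auto intro!: derivative_eq_intros\<close>)
  from DERIV_cmult[OF this, of "a j * 2 ^ (j * k)"]
  show "(atom k a q j has_real_derivative atom (Suc k) a q j y) (at y within UNIV)"
    by (simp add: atom_def[abs_def] power_add mult_ac)
next
  show "uniformly_convergent_on UNIV (\<lambda>n x. \<Sum>j<n. atom (Suc k) a q j x)"
    using lac_uniform_limit[OF a assms(2,3)] uniformly_convergent_on_def by blast
  show "summable (\<lambda>j. atom k a q j x)"
  proof (rule summable_comparison_test)
    show "\<exists>n. \<forall>j\<ge>n. norm (atom k a q j x) \<le> c * D * (2 powr (- (\<gamma> - real k))) ^ j"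
      using atom_bound[OF a, of k] assms by auto
    show "summable (\<lambda>j. c * D * (2 powr (- (\<gamma> - real k))) ^ j)"
      using assms by (intro summable_atom_bound) auto
  qed
qed auto

text \<open>Interpolation, at the scaled distance z, between the Lipschitz bound D z (used for z <=
  1) and the oscillation bound 2 D (used for z > 1). The powers of 2^j cancel, so the constant does
  not depend on the level.\<close>

lemma atom_holder:
  assumes a: "\<And>j. \<bar>a j\<bar> \<le> c * 2 powr (- (real j * \<gamma>))" and "Suc k \<le> N"
    and e: "0 < \<gamma> - real k" "\<gamma> - real k \<le> 1"
  shows "\<bar>atom k a q j x - atom k a q j y\<bar> \<le> 2 * c * D * \<bar>x - y\<bar> powr (\<gamma> - real k)"
proof (cases "x = y")
  case False
  define e where "e = \<gamma> - real k"
  define z where "z = 2 ^ j * \<bar>x - y\<bar>"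
  have z: "z > 0" using False by (simp add: z_def)
  have c: "c \<ge> 0" using order_trans[OF abs_ge_zero a[of 0]] by simp
  have "\<bar>\<psi> k u - \<psi> k v\<bar> \<le> D * \<bar>u - v\<bar>" for u v
    using field_differentiable_bound[of UNIV "\<psi> k" "\<psi> (Suc k)" D u v] \<psi>_deriv[of k] \<psi>_bound[of "Suc k"] assms(2)
    by auto
  from this[of "2 ^ j * (x - q) - real A" "2 ^ j * (y - q) - real A"]
  have 1: "\<bar>\<psi> k (2 ^ j * (x - q) - real A) - \<psi> k (2 ^ j * (y - q) - real A)\<bar> \<le> D * z"
    by (simp add: z_def right_diff_distrib[symmetric] abs_mult)
  have 2: "\<bar>\<psi> k (2 ^ j * (x - q) - real A) - \<psi> k (2 ^ j * (y - q) - real A)\<bar> \<le> 2 * D"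
    using \<psi>_bound[of k "2 ^ j * (x - q) - real A"] \<psi>_bound[of k "2 ^ j * (y - q) - real A"] assms(2)
    by linarith
  have 3: "\<bar>\<psi> k (2 ^ j * (x - q) - real A) - \<psi> k (2 ^ j * (y - q) - real A)\<bar> \<le> 2 * D * z powr e"
  proof (cases "z \<le> 1")
    case True
    have "z = z powr 1" using z by simp
    also have "\<dots> \<le> z powr e" using True z e unfolding e_def by (intro powr_mono') auto
    finally have "D * z \<le> 2 * D * z powr e" using D z by (intro mult_mono) auto
    with 1 show ?thesis by linarith
  next
    case False
    then have "1 \<le> z powr e" using e by (intro ge_one_powr_ge_zero) (auto simp: e_def)
    then have "2 * D * 1 \<le> 2 * D * z powr e" using D by (intro mult_left_mono) auto
    with 2 show ?thesis by linarith
  qed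
  have zp: "z powr e = 2 powr (real j * e) * \<bar>x - y\<bar> powr e"
    by (simp add: z_def two_powr_nat powr_mult powr_powr)
  have "\<bar>atom k a q j x - atom k a q j y\<bar> =
      \<bar>a j\<bar> * 2 ^ (j * k) * \<bar>\<psi> k (2 ^ j * (x - q) - real A) - \<psi> k (2 ^ j * (y - q) - real A)\<bar>"
    by (simp add: atom_def right_diff_distrib[symmetric] abs_mult)
  also have "\<dots> \<le> (c * 2 powr (- (real j * \<gamma>))) * 2 ^ (j * k) * (2 * D * z powr e)"
    using 3 c D by (intro mult_mono a) auto
  also have "\<dots> = 2 * c * D * \<bar>x - y\<bar> powr e * (2 powr (- (real j * \<gamma>)) * 2 ^ (j * k) * 2 powr (real j * e))"
    by (simp add: zp mult_ac)
  also have "2 powr (- (real j * \<gamma>)) * 2 ^ (j * k) * 2 powr (real j * e) =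
      2 powr (- (real j * \<gamma>) + real (j * k) + real j * e)"
    unfolding powr_add by (simp only: two_powr_nat)
  also have "- (real j * \<gamma>) + real (j * k) + real j * e = 0" by (simp add: e_def algebra_simps)
  finally show ?thesis by (simp add: e_def)
qed auto

text \<open>The constant doubles for two points in different atoms: each atom vanishes at the other
  point, and two single-atom differences are added.\<close>

lemma lac_holder:
  assumes a: "\<And>j. \<bar>a j\<bar> \<le> c * 2 powr (- (real j * \<gamma>))" and "Suc k \<le> N"
    and e: "0 < \<gamma> - real k" "\<gamma> - real k \<le> 1"
  shows "\<bar>lac k a q x - lac k a q y\<bar> \<le> 4 * c * D * \<bar>x - y\<bar> powr (\<gamma> - real k)"
proof -
  have kN: "k \<le> N" using assms by simp
  obtain i where i: "lac k a q x = atom k a q i x" "\<And>l. l \<noteq> i \<Longrightarrow> atom k a q l x = 0"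
    using lac_cases[OF kN] by blast
  obtain j where j: "lac k a q y = atom k a q j y" "\<And>l. l \<noteq> j \<Longrightarrow> atom k a q l y = 0"
    using lac_cases[OF kN] by blast
  note h = atom_holder[OF a assms(2) e, of q _ x y]
  have nn: "0 \<le> 2 * c * D * \<bar>x - y\<bar> powr (\<gamma> - real k)" using h[of 0] by linarith
  show ?thesis
  proof (cases "i = j")
    case True
    then show ?thesis using h[of i] i(1) j(1) nn by simp
  next
    case False
    then have "atom k a q j x = 0" "atom k a q i y = 0" using i(2) j(2) by auto
    then show ?thesis using h[of i] h[of j] i(1) j(1) by simp
  qed
qed

lemma holder_floor_bounds:
  assumes "\<gamma> > 0"
  shows "0 < \<gamma> - real (holder_floor \<gamma>)" "\<gamma> - real (holder_floor \<gamma>) \<le> 1"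
proof -
  have "real (holder_floor \<gamma>) = of_int \<lceil>\<gamma>\<rceil> - 1" using assms by (simp add: holder_floor_def)
  then show "0 < \<gamma> - real (holder_floor \<gamma>)" "\<gamma> - real (holder_floor \<gamma>) \<le> 1" by linarith+
qed

lemma lac_in_holder_class:
  assumes a: "\<And>j. \<bar>a j\<bar> \<le> c * 2 powr (- (real j * \<gamma>))" and "0 < \<gamma>" "\<gamma> \<le> real N"
  shows "lac 0 a q \<in> holder_class \<gamma> (4 * c * D)"
proof -
  note hf = holder_floor_bounds[OF assms(2)]
  \<comment> \<open>The Lipschitz bound on an atom costs one derivative beyond the Hoelder
    floor.\<close>
  have SN: "Suc (holder_floor \<gamma>) \<le> N" using hf assms(3) by linarith
  have deriv: "(lac k a q has_real_derivative lac (Suc k) a q x) (at x)" if "k < holder_floor \<gamma>" for k x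
    using DERIV_lac[OF a, of k] that SN hf by simp
  have pow: "k \<le> holder_floor \<gamma> \<Longrightarrow> (deriv ^^ k) (lac 0 a q) = lac k a q" for k
  proof (induction k)
    case (Suc k)
    then show ?case using deriv[of k] by (auto intro!: ext DERIV_imp_deriv)
  qed simp
  show ?thesis
    unfolding holder_class_def
  proof (intro CollectI conjI allI impI)
    fix k t assume k: "k < holder_floor \<gamma>"
    show "(deriv ^^ k) (lac 0 a q) differentiable (at t)"
      using deriv[OF k] pow[of k] k real_differentiable_def by auto
  next
    fix t t'
    show "\<bar>(deriv ^^ holder_floor \<gamma>) (lac 0 a q) t - (deriv ^^ holder_floor \<gamma>) (lac 0 a q) t'\<bar>
       \<le> 4 * c * D * \<bar>t - t'\<bar> powr (\<gamma> - real (holder_floor \<gamma>))"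
      using lac_holder[OF a SN hf] pow by simp
  qed
qed

lemma lac_nonzeroD:
  assumes "\<And>j. j < j0 \<Longrightarrow> a j = 0" "lac 0 a q x \<noteq> 0"
  shows "q < x" "x < q + (real A + 1) / 2 ^ j0"
proof -
  obtain j where j: "lac 0 a q x = atom 0 a q j x" using lac_cases[of 0] by blast
  with assms(2) have nz: "\<bar>2 ^ j * (x - q) - real A\<bar> < s" "a j \<noteq> 0"
    using atom_nonzeroD[of 0] by auto
  then have "j0 \<le> j" using assms(1) not_less by blast
  then have p: "(2::real) ^ j0 \<le> 2 ^ j" by simp
  have A4: "real A \<ge> 4" using A C by simp
  have "2 ^ j * (x - q) > 0" using nz s A4 by linarith
  then have pos: "x - q > 0" by (simp add: zero_less_mult_iff)
  then show "q < x" by simp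
  have "2 ^ j0 * (x - q) \<le> 2 ^ j * (x - q)" using p pos by simp
  also have "\<dots> < real A + 1" using nz s by linarith
  finally show "x < q + (real A + 1) / 2 ^ j0" by (simp add: field_simps)
qed

lemma lac_abs_le:
  assumes "\<And>j. \<bar>a j\<bar> \<le> b"
  shows "\<bar>lac 0 a q x\<bar> \<le> b"
proof -
  obtain j where j: "lac 0 a q x = atom 0 a q j x" using lac_cases[of 0] by blast
  have "\<bar>atom 0 a q j x\<bar> \<le> \<bar>a j\<bar> * 1"
    unfolding atom_def abs_mult using \<psi>_range[of "2 ^ j * (x - q) - real A"] by (intro mult_mono) auto
  then show ?thesis using j assms[of j] by simp
qed

text \<open>Within the range of the kernel at level j only the atom of level j is alive. The bound
  has the shape of the premise on \<open>F\<close> in \<open>kernel_op_bias\<close>.\<close>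

lemma lac_window:
  assumes "\<bar>2 ^ j * (x - q) - real A\<bar> \<le> real C"
  shows "\<bar>lac 0 a q x\<bar> \<le> (if \<bar>2 ^ j * (x - q) - real A\<bar> \<le> s then \<bar>a j\<bar> else 0)"
proof -
  have "atom 0 a q i x = 0" if "i \<noteq> j" for i
    using dyadic_window_disjoint[OF assms, of i] atom_nonzeroD(1)[of 0 a q i x] that s by fastforce
  then have "lac 0 a q x = atom 0 a q j x" by (rule lac_eq_atom)
  also have "\<bar>\<dots>\<bar> \<le> (if \<bar>2 ^ j * (x - q) - real A\<bar> \<le> s then \<bar>a j\<bar> else 0)"
    using \<psi>_zero[of 0 "2 ^ j * (x - q) - real A"] \<psi>_range[of "2 ^ j * (x - q) - real A"]
    by (auto simp: atom_def abs_mult intro!: mult_left_le)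
  finally show ?thesis .
qed

lemma lac_peak: "lac 0 a q (q + real A / 2 ^ j) = a j"
proof -
  let ?x = "q + real A / 2 ^ j"
  have e: "2 ^ j * (?x - q) - real A = 0" by simp
  have "atom 0 a q i ?x = 0" if "i \<noteq> j" for i
    using dyadic_window_disjoint[of j "?x - q" i] atom_nonzeroD(1)[of 0 a q i ?x] that s e by fastforce
  then have "lac 0 a q ?x = atom 0 a q j ?x" by (rule lac_eq_atom)
  then show ?thesis using \<psi>_centre by (simp add: atom_def)
qed

end

section \<open>Sums and larger constants in Hoelder classes\<close>

lemma holder_class_add:
  assumes f: "f \<in> holder_class \<gamma> B" and g: "g \<in> holder_class \<gamma> B'"
  shows "(\<lambda>x. f x + g x) \<in> holder_class \<gamma> (B + B')"
proof -
  let ?m = "holder_floor \<gamma>"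
  have df: "(deriv ^^ k) f differentiable at t" "(deriv ^^ k) g differentiable at t" if "k < ?m" for k t
    using f g that unfolding holder_class_def by auto
  have pow: "k \<le> ?m \<Longrightarrow> (deriv ^^ k) (\<lambda>x. f x + g x) = (\<lambda>x. (deriv ^^ k) f x + (deriv ^^ k) g x)" for k
  proof (induction k)
    case (Suc k)
    then have "(deriv ^^ Suc k) (\<lambda>x. f x + g x) = deriv (\<lambda>x. (deriv ^^ k) f x + (deriv ^^ k) g x)" by simp
    also have "\<dots> = (\<lambda>x. (deriv ^^ Suc k) f x + (deriv ^^ Suc k) g x)"
      using df[of k] Suc.prems
      by (auto intro!: ext DERIV_imp_deriv DERIV_add simp: DERIV_deriv_iff_real_differentiable)
    finally show ?case .
  qed simp
  show ?thesis
    unfolding holder_class_def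
  proof (intro CollectI conjI allI impI)
    fix k t assume k: "k < ?m"
    then show "(deriv ^^ k) (\<lambda>x. f x + g x) differentiable (at t)"
      using df[OF k, of t] pow[of k] by simp
  next
    fix t t'
    have "\<bar>(deriv ^^ ?m) f t - (deriv ^^ ?m) f t'\<bar> \<le> B * \<bar>t - t'\<bar> powr (\<gamma> - real ?m)"
      "\<bar>(deriv ^^ ?m) g t - (deriv ^^ ?m) g t'\<bar> \<le> B' * \<bar>t - t'\<bar> powr (\<gamma> - real ?m)"
      using f g unfolding holder_class_def by auto
    then show "\<bar>(deriv ^^ ?m) (\<lambda>x. f x + g x) t - (deriv ^^ ?m) (\<lambda>x. f x + g x) t'\<bar>
        \<le> (B + B') * \<bar>t - t'\<bar> powr (\<gamma> - real ?m)"
      by (simp add: pow algebra_simps)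
  qed
qed

lemma holder_class_mono:
  assumes "f \<in> holder_class \<gamma> B" "B \<le> B'"
  shows "f \<in> holder_class \<gamma> B'"
  using assms unfolding holder_class_def
  by (auto intro: order_trans[OF _ mult_right_mono[OF assms(2)]])

section \<open>The bias of the kernel operator\<close>

text \<open>This yields the bound V of \<open>K 0\<close>, which has a zero beyond the range of the
  kernel; two-point partitions suffice.\<close>

lemma bounded_variation_line_bounded:
  assumes "bounded_variation_line g" "g z = 0"
  shows "\<exists>V. \<forall>x. \<bar>g x\<bar> \<le> V"
proof -
  obtain V where V: "\<And>ts m. mono ts \<Longrightarrow> (\<Sum>i<m. \<bar>g (ts (Suc i)) - g (ts i)\<bar>) \<le> V"
    using assms(1) unfolding bounded_variation_line_def by blast
  have *: "\<bar>g y - g x\<bar> \<le> V" if "x \<le> y" for x y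
  proof -
    have "mono (\<lambda>i::nat. if i = 0 then x else y)" using that by (auto simp: mono_def)
    from V[OF this, of 1] show ?thesis by simp
  qed
  have "\<bar>g x\<bar> \<le> V" for x
    using *[of x z] *[of z x] assms(2) by (cases "x \<le> z") auto
  then show ?thesis by blast
qed

text \<open>At a dyadic point \<open>t = z 2\<^sup>-\<^sup>j\<close> periodicity reduces \<open>K\<^sub>j\<close> to the fixed function \<open>K 0\<close>, so that
  a bump of width \<open>s 2\<^sup>-\<^sup>j\<close> around \<open>t\<close> is averaged out if \<open>s\<close> is small. A non-integrable integrand has
  integral \<open>0\<close>, for which the bound holds as well.\<close>

lemma kernel_op_bias:
  fixes t :: real and z :: int
  assumes V: "\<And>v. \<bar>K 0 v\<bar> \<le> V"
    and supp: "\<And>x y. \<bar>x - y\<bar> > C \<Longrightarrow> K y x = 0"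
    and per: "\<And>(k::int) x y. K y x = K (y - of_int k) (x - of_int k)"
    and s: "0 < s" "4 * s * V \<le> 1"
    and t: "2 ^ j * t = of_int z"
    and F: "\<And>x. \<bar>2 ^ j * (x - t)\<bar> \<le> C \<Longrightarrow> \<bar>F x\<bar> \<le> (if \<bar>2 ^ j * (x - t)\<bar> \<le> s then b else 0)"
    and Ft: "\<bar>F t\<bar> = b"
  shows "b / 2 \<le> \<bar>kernel_op K (int j) F t - F t\<bar>"
proof -
  let ?I = "{t - s / 2 ^ j .. t + s / 2 ^ j}"
  let ?f = "\<lambda>x. kernel_scale K (int j) t x * F x"
  have b: "b \<ge> 0" using Ft by simp
  have K: "\<bar>K (2 ^ j * t) x\<bar> \<le> V" for x
    using V[of "x - of_int z"] per[of "2 ^ j * t" x z] t by simp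
  have le: "\<bar>?f x\<bar> \<le> 2 ^ j * V * b * indicator ?I x" for x
  proof (cases "\<bar>2 ^ j * (x - t)\<bar> \<le> C")
    case True
    note Fx = F[OF True]
    have iff: "\<bar>2 ^ j * (x - t)\<bar> \<le> s \<longleftrightarrow> x \<in> ?I"
      by (auto simp: abs_le_iff field_simps)
    have "\<bar>?f x\<bar> = 2 ^ j * \<bar>K (2 ^ j * t) (2 ^ j * x)\<bar> * \<bar>F x\<bar>"
      by (simp add: kernel_scale_def abs_mult)
    also have "\<dots> \<le> 2 ^ j * V * (if \<bar>2 ^ j * (x - t)\<bar> \<le> s then b else 0)"
      using K b order_trans[OF abs_ge_zero K] by (intro mult_mono Fx) auto
    finally show ?thesis unfolding iff by (auto simp: indicator_def split: if_splits)
  next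
    case False
    then have "K (2 ^ j * t) (2 ^ j * x) = 0" by (intro supp) (simp add: right_diff_distrib)
    then show ?thesis using b order_trans[OF abs_ge_zero K] by (simp add: kernel_scale_def)
  qed
  have "\<bar>kernel_op K (int j) F t\<bar> \<le> b / 2"
  proof (cases "integrable lborel ?f")
    case True
    have "\<bar>kernel_op K (int j) F t\<bar> \<le> (LINT x|lborel. \<bar>?f x\<bar>)"
      unfolding kernel_op_def by (rule integral_abs_bound)
    also have "\<dots> \<le> (LINT x|lborel. 2 ^ j * V * b * indicator ?I x)"
      using True by (intro integral_mono le integrable_abs integrable_mult_right integrable_real_indicator)
        (auto simp: emeasure_lborel_Icc_eq)
    \<comment> \<open>The interval has length 2 s / 2^j, which cancels the factor 2^j of the scaled
      kernel; by 4 s V <= 1 at most half of the peak b survives.\<close>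
    also have "\<dots> = 2 * s * V * b" using s by (simp add: field_simps)
    also have "\<dots> \<le> b / 2" using mult_right_mono[OF s(2) b] by simp
    finally show ?thesis .
  next
    case False
    then show ?thesis unfolding kernel_op_def using b by (simp add: not_integrable_integral_eq)
  qed
  with Ft show ?thesis by linarith
qed

section \<open>Shifts of Gaussian product measures\<close>

text \<open>A finite product measure is determined by its values on boxes, and on a box the integral
  of the product density factorises.\<close>

lemma PiM_density:
  fixes f :: "'i \<Rightarrow> 'a \<Rightarrow> ennreal"
  assumes "finite I" and M: "\<And>i. prob_space (M i)" and Mf: "\<And>i. prob_space (density (M i) (f i))"
    and f[measurable]: "\<And>i. f i \<in> borel_measurable (M i)"
  shows "(\<Pi>\<^sub>M i\<in>I. density (M i) (f i)) = density (Pi\<^sub>M I M) (\<lambda>x. \<Prod>i\<in>I. f i (x i))"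
proof -
  interpret P: product_sigma_finite M
    using M by (intro product_sigma_finite.intro prob_space_imp_sigma_finite) auto
  interpret Q: product_sigma_finite "\<lambda>i. density (M i) (f i)"
    using Mf by (intro product_sigma_finite.intro prob_space_imp_sigma_finite) auto
  have meas[measurable]: "(\<lambda>x. \<Prod>i\<in>I. f i (x i)) \<in> borel_measurable (Pi\<^sub>M I M)" by measurable
  show ?thesis
  proof (rule Q.PiM_eqI[OF assms(1), symmetric])
    show "sets (density (Pi\<^sub>M I M) (\<lambda>x. \<Prod>i\<in>I. f i (x i))) = sets (\<Pi>\<^sub>M i\<in>I. density (M i) (f i))"
      by (simp cong: sets_PiM_cong)
  next
    fix A assume A: "\<And>i. i \<in> I \<Longrightarrow> A i \<in> sets (density (M i) (f i))"
    then have A': "\<And>i. i \<in> I \<Longrightarrow> A i \<in> sets (M i)" by simp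
    have "Pi\<^sub>E I A \<in> sets (Pi\<^sub>M I M)" using A' assms(1) by (intro sets_PiM_I_finite) auto
    then have "emeasure (density (Pi\<^sub>M I M) (\<lambda>x. \<Prod>i\<in>I. f i (x i))) (Pi\<^sub>E I A) =
        (\<integral>\<^sup>+x. (\<Prod>i\<in>I. f i (x i)) * indicator (Pi\<^sub>E I A) x \<partial>Pi\<^sub>M I M)"
      by (rule emeasure_density[OF meas])
    also have "\<dots> = (\<integral>\<^sup>+x. (\<Prod>i\<in>I. f i (x i) * indicator (A i) (x i)) \<partial>Pi\<^sub>M I M)"
    proof (rule nn_integral_cong)
      fix x assume "x \<in> space (Pi\<^sub>M I M)"
      then have "x \<in> extensional I" by (auto simp: space_PiM PiE_def)
      then have "indicator (Pi\<^sub>E I A) x = (\<Prod>i\<in>I. indicator (A i) (x i) :: ennreal)"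
        using assms(1) by (auto simp: indicator_def PiE_def Pi_def prod_zero_iff intro!: prod.neutral)
      then show "(\<Prod>i\<in>I. f i (x i)) * indicator (Pi\<^sub>E I A) x = (\<Prod>i\<in>I. f i (x i) * indicator (A i) (x i))"
        by (simp add: prod.distrib)
    qed
    also have "\<dots> = (\<Prod>i\<in>I. \<integral>\<^sup>+x. f i x * indicator (A i) x \<partial>M i)"
      using assms(1) A' by (intro P.product_nn_integral_prod) auto
    also have "\<dots> = (\<Prod>i\<in>I. emeasure (density (M i) (f i)) (A i))"
      using A' by (intro prod.cong refl emeasure_density[symmetric]) auto
    finally show "emeasure (density (Pi\<^sub>M I M) (\<lambda>x. \<Prod>i\<in>I. f i (x i))) (Pi\<^sub>E I A) =
      (\<Prod>i\<in>I. emeasure (density (M i) (f i)) (A i))" .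
  qed
qed

definition gauss :: "real \<Rightarrow> real \<Rightarrow> real measure" where
  "gauss d s = density lborel (\<lambda>x. ennreal (normal_density d s x))"

text \<open>The density of N(d, s^2) with respect to N(0, s^2), a one-dimensional Cameron-Martin
  factor.\<close>

definition gauss_lr :: "real \<Rightarrow> real \<Rightarrow> real \<Rightarrow> real" where
  "gauss_lr s d x = exp (d * x / s\<^sup>2 - d\<^sup>2 / (2 * s\<^sup>2))"

lemma sets_gauss[simp, measurable_cong]: "sets (gauss d s) = sets borel"
  and space_gauss[simp]: "space (gauss d s) = UNIV"
  by (simp_all add: gauss_def)

lemma borel_measurable_gauss_lr[measurable]: "gauss_lr s d \<in> borel_measurable borel"
  unfolding gauss_lr_def[abs_def] by measurable

lemma prob_space_gauss: "s > 0 \<Longrightarrow> prob_space (gauss d s)"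
  unfolding gauss_def by (rule prob_space_normal_density)

lemma normal_density_shift:
  assumes "s > 0"
  shows "normal_density 0 s x * gauss_lr s d x = normal_density d s x"
proof -
  have "- (x - 0)\<^sup>2 / (2 * s\<^sup>2) + (d * x / s\<^sup>2 - d\<^sup>2 / (2 * s\<^sup>2)) = - (x - d)\<^sup>2 / (2 * s\<^sup>2)"
    using assms by (simp add: field_simps power2_eq_square)
  then show ?thesis
    unfolding normal_density_def gauss_lr_def by (simp add: exp_add[symmetric] mult.assoc)
qed

lemma gauss_eq_density:
  assumes "s > 0"
  shows "gauss d s = density (gauss 0 s) (\<lambda>x. ennreal (gauss_lr s d x))"
proof -
  have "ennreal (normal_density 0 s x) * ennreal (gauss_lr s d x) = ennreal (normal_density d s x)" for x
    by (simp add: ennreal_mult'[symmetric] normal_density_shift[OF assms])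
  then show ?thesis
    unfolding gauss_def by (subst density_density_eq) auto
qed

lemma gauss_lr_mult:
  assumes "s > 0"
  shows "gauss_lr s d x * gauss_lr s e x = exp (d * e / s\<^sup>2) * gauss_lr s (d + e) x"
  unfolding gauss_lr_def exp_add[symmetric] using assms by (simp add: field_simps power2_eq_square)

lemma gauss_lr_integral:
  assumes "s > 0"
  shows "integrable (gauss 0 s) (gauss_lr s d)" "(\<integral>x. gauss_lr s d x \<partial>gauss 0 s) = 1"
  unfolding gauss_def
  by (simp_all add: integrable_density integral_density normal_density_shift[OF assms] assms)

text \<open>By \<open>gauss_lr_mult\<close> a product of two likelihood ratios is exp (d e / s^2)
  times the one for the shift d + e, which integrates to 1.\<close>

lemma gauss_lr_product_integral:
  assumes "finite I" and s: "\<And>i. s i > 0"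
  shows "integrable (\<Pi>\<^sub>M i\<in>I. gauss 0 (s i)) (\<lambda>x. (\<Prod>i\<in>I. gauss_lr (s i) (d i) (x i)) * (\<Prod>i\<in>I. gauss_lr (s i) (e i) (x i)))"
    and "(\<integral>x. (\<Prod>i\<in>I. gauss_lr (s i) (d i) (x i)) * (\<Prod>i\<in>I. gauss_lr (s i) (e i) (x i)) \<partial>(\<Pi>\<^sub>M i\<in>I. gauss 0 (s i)))
      = exp (\<Sum>i\<in>I. d i * e i / (s i)\<^sup>2)"
proof -
  interpret P: product_sigma_finite "\<lambda>i. gauss 0 (s i)"
    using s by (intro product_sigma_finite.intro prob_space_imp_sigma_finite prob_space_gauss)
  have int: "integrable (gauss 0 (s i)) (\<lambda>x. gauss_lr (s i) (d i) x * gauss_lr (s i) (e i) x)" for i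
    unfolding gauss_lr_mult[OF s] by (intro integrable_mult_right gauss_lr_integral s)
  show "integrable (\<Pi>\<^sub>M i\<in>I. gauss 0 (s i)) (\<lambda>x. (\<Prod>i\<in>I. gauss_lr (s i) (d i) (x i)) * (\<Prod>i\<in>I. gauss_lr (s i) (e i) (x i)))"
    unfolding prod.distrib[symmetric] using assms(1) int by (rule P.product_integrable_prod)
  have "(\<integral>x. (\<Prod>i\<in>I. gauss_lr (s i) (d i) (x i) * gauss_lr (s i) (e i) (x i)) \<partial>(\<Pi>\<^sub>M i\<in>I. gauss 0 (s i)))
     = (\<Prod>i\<in>I. \<integral>x. gauss_lr (s i) (d i) x * gauss_lr (s i) (e i) x \<partial>gauss 0 (s i))"
    using assms(1) int by (rule P.product_integral_prod)
  also have "\<dots> = (\<Prod>i\<in>I. exp (d i * e i / (s i)\<^sup>2))"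
    unfolding gauss_lr_mult[OF s] using gauss_lr_integral[OF s] by (intro prod.cong) simp_all
  also have "\<dots> = exp (\<Sum>i\<in>I. d i * e i / (s i)\<^sup>2)" using assms(1) by (simp add: exp_sum)
  finally show "(\<integral>x. (\<Prod>i\<in>I. gauss_lr (s i) (d i) (x i)) * (\<Prod>i\<in>I. gauss_lr (s i) (e i) (x i)) \<partial>(\<Pi>\<^sub>M i\<in>I. gauss 0 (s i)))
      = exp (\<Sum>i\<in>I. d i * e i / (s i)\<^sup>2)"
    by (simp add: prod.distrib)
qed

text \<open>The second moment of the mixture likelihood ratio, in which the cross terms vanish by
  orthogonality of the shifts.\<close>

lemma gauss_mixture_distance:
  fixes d :: "nat \<Rightarrow> 'i \<Rightarrow> real"
  assumes "finite I" and s: "\<And>i. s i > 0" and "m > 0"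
    and orth: "\<And>k l. k < m \<Longrightarrow> l < m \<Longrightarrow> k \<noteq> l \<Longrightarrow> (\<Sum>i\<in>I. d k i * d l i / (s i)\<^sup>2) = 0"
    and norm: "\<And>k. k < m \<Longrightarrow> (\<Sum>i\<in>I. (d k i)\<^sup>2 / (s i)\<^sup>2) \<le> b"
    and S: "S \<in> sets (\<Pi>\<^sub>M i\<in>I. borel)"
  shows "\<bar>measure (\<Pi>\<^sub>M i\<in>I. gauss 0 (s i)) S - (\<Sum>k<m. measure (\<Pi>\<^sub>M i\<in>I. gauss (d k i) (s i)) S) / m\<bar>
    \<le> sqrt (exp b / m)"
proof -
  define Q where "Q = (\<Pi>\<^sub>M i\<in>I. gauss 0 (s i))"
  define Z where "Z k x = (\<Prod>i\<in>I. gauss_lr (s i) (d k i) (x i))" for k x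
  \<comment> \<open>The centred density of the mixture with respect to the unshifted law; its second
    moment is a chi-square distance.\<close>
  define Y where "Y x = (\<Sum>k<m. Z k x) / m - 1" for x
  interpret prob_space Q
    unfolding Q_def by (intro prob_space_PiM prob_space_gauss s)
  have sets_Q[measurable_cong]: "sets Q = sets (\<Pi>\<^sub>M i\<in>I. borel)" unfolding Q_def by (intro sets_PiM_cong) auto
  have S': "S \<in> sets Q" using S sets_Q by simp
  have Z_nonneg: "Z k x \<ge> 0" for k x unfolding Z_def by (intro prod_nonneg) (simp add: gauss_lr_def)
  have Z_meas[measurable]: "Z k \<in> borel_measurable Q" for k
    unfolding Z_def[abs_def] by measurable
  have ZZ: "integrable Q (\<lambda>x. Z k x * Z l x)" "(\<integral>x. Z k x * Z l x \<partial>Q) = exp (\<Sum>i\<in>I. d k i * d l i / (s i)\<^sup>2)" for k l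
    unfolding Z_def Q_def by (rule gauss_lr_product_integral[OF assms(1) s])+
  have Z1: "integrable Q (Z k)" "(\<integral>x. Z k x \<partial>Q) = 1" for k
    using gauss_lr_product_integral[OF assms(1) s, where d = "d k" and e = "\<lambda>_. 0"]
    by (simp_all add: gauss_lr_def[of _ 0] Z_def[abs_def] Q_def)
  have shifted: "measure (\<Pi>\<^sub>M i\<in>I. gauss (d k i) (s i)) S = (\<integral>x. Z k x * indicator S x \<partial>Q)" for k
  proof -
    have "(\<Pi>\<^sub>M i\<in>I. gauss (d k i) (s i)) = (\<Pi>\<^sub>M i\<in>I. density (gauss 0 (s i)) (\<lambda>x. ennreal (gauss_lr (s i) (d k i) x)))"
      by (intro PiM_cong refl gauss_eq_density s)
    also have "\<dots> = density Q (\<lambda>x. \<Prod>i\<in>I. ennreal (gauss_lr (s i) (d k i) (x i)))"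
      unfolding Q_def using assms(1) s
      by (intro PiM_density) (auto intro: prob_space_gauss simp: gauss_eq_density[symmetric])
    also have "\<dots> = density Q (\<lambda>x. ennreal (Z k x))"
      unfolding Z_def by (simp add: prod_ennreal gauss_lr_def)
    finally have "measure (\<Pi>\<^sub>M i\<in>I. gauss (d k i) (s i)) S = enn2real (\<integral>\<^sup>+x. ennreal (Z k x) * indicator S x \<partial>Q)"
      using S' by (simp add: measure_def emeasure_density)
    also have "(\<integral>\<^sup>+x. ennreal (Z k x) * indicator S x \<partial>Q) = (\<integral>\<^sup>+x. ennreal (Z k x * indicator S x) \<partial>Q)"
      by (intro nn_integral_cong) (auto simp: indicator_def)
    also have "enn2real \<dots> = (\<integral>x. Z k x * indicator S x \<partial>Q)"
      using S' Z_nonneg by (subst integral_eq_nn_integral) (auto intro!: AE_I2)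
    finally show ?thesis .
  qed
  have Y_meas[measurable]: "Y \<in> borel_measurable Q" unfolding Y_def[abs_def] by measurable
  have Y_int: "integrable Q Y"
    unfolding Y_def[abs_def] by (intro Bochner_Integration.integrable_diff integrable_divide_zero Bochner_Integration.integrable_sum Z1) auto
  have Y2: "(Y x)\<^sup>2 = (\<Sum>k<m. \<Sum>l<m. Z k x * Z l x) / m\<^sup>2 - 2 * (\<Sum>k<m. Z k x) / m + 1" for x
    unfolding Y_def sum_product[symmetric] using assms(3) by (simp add: field_simps power2_eq_square)
  have Y2_int: "integrable Q (\<lambda>x. (Y x)\<^sup>2)"
    unfolding Y2 using ZZ Z1 by simp
  have "(\<integral>x. (Y x)\<^sup>2 \<partial>Q) = (\<Sum>k<m. \<Sum>l<m. exp (\<Sum>i\<in>I. d k i * d l i / (s i)\<^sup>2)) / m\<^sup>2 - 1"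
    unfolding Y2 using ZZ Z1 assms(3) prob_space by simp
  \<comment> \<open>On the diagonal 1 + exp b replaces exp b, so that the m^2 ones cancel the
    subtracted 1 exactly.\<close>
  also have "\<dots> \<le> (\<Sum>k<m. \<Sum>l<m. 1 + (if l = k then exp b else 0)) / m\<^sup>2 - 1"
  proof (intro diff_right_mono divide_right_mono sum_mono)
    fix k l assume "k \<in> {..<m}" "l \<in> {..<m}"
    then show "exp (\<Sum>i\<in>I. d k i * d l i / (s i)\<^sup>2) \<le> 1 + (if l = k then exp b else 0)"
      using orth[of k l] norm[of k] by (cases "l = k") (auto simp: power2_eq_square intro: add_increasing)
  qed simp
  also have "(\<Sum>k<m. \<Sum>l<m. 1 + (if l = k then exp b else 0)) = real m * real m + real m * exp b"
    by (simp add: sum.distrib distrib_left)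
  also have "(real m * real m + real m * exp b) / m\<^sup>2 - 1 = exp b / m"
    using assms(3) by (simp add: field_simps power2_eq_square)
  finally have EY2: "(\<integral>x. (Y x)\<^sup>2 \<partial>Q) \<le> exp b / m" .
  have EY: "(\<integral>x. \<bar>Y x\<bar> \<partial>Q) \<le> sqrt (\<integral>x. (Y x)\<^sup>2 \<partial>Q)"
  proof (rule real_le_rsqrt)
    \<comment> \<open>Nonnegative variance of |Y| serves as the Cauchy-Schwarz inequality.\<close>
    have "0 \<le> variance (\<lambda>x. \<bar>Y x\<bar>)" by (rule variance_positive)
    also have "variance (\<lambda>x. \<bar>Y x\<bar>) = (\<integral>x. (Y x)\<^sup>2 \<partial>Q) - (\<integral>x. \<bar>Y x\<bar> \<partial>Q)\<^sup>2"
      using Y_int Y2_int by (subst variance_eq) auto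
    finally show "(\<integral>x. \<bar>Y x\<bar> \<partial>Q)\<^sup>2 \<le> (\<integral>x. (Y x)\<^sup>2 \<partial>Q)" by simp
  qed
  have int_ind: "integrable Q (\<lambda>x. f x * indicator S x)" if "integrable Q f" for f :: "_ \<Rightarrow> real"
    using integrable_mult_indicator[OF S' that] by (simp add: mult.commute)
  have "(\<Sum>k<m. measure (\<Pi>\<^sub>M i\<in>I. gauss (d k i) (s i)) S) / m - measure Q S = (\<integral>x. Y x * indicator S x \<partial>Q)"
  proof -
    have "(\<integral>x. Y x * indicator S x \<partial>Q) = (\<integral>x. (\<Sum>k<m. Z k x * indicator S x) / m - indicator S x \<partial>Q)"
      by (simp add: Y_def sum_distrib_right[symmetric] left_diff_distrib)
    also have "\<dots> = (\<integral>x. (\<Sum>k<m. Z k x * indicator S x) / m \<partial>Q) - (\<integral>x. indicator S x \<partial>Q)"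
      using S' int_ind[OF Z1(1)]
      by (intro Bochner_Integration.integral_diff integrable_divide_zero Bochner_Integration.integrable_sum
          integrable_real_indicator) (auto simp: emeasure_eq_measure)
    also have "\<dots> = (\<Sum>k<m. \<integral>x. Z k x * indicator S x \<partial>Q) / m - measure Q S"
      using S' int_ind[OF Z1(1)]
      by (subst integral_divide_zero, subst Bochner_Integration.integral_sum) auto
    finally show ?thesis by (simp add: shifted)
  qed
  also have "\<bar>\<integral>x. Y x * indicator S x \<partial>Q\<bar> \<le> (\<integral>x. \<bar>Y x * indicator S x\<bar> \<partial>Q)" by (rule integral_abs_bound)
  also have "\<dots> \<le> (\<integral>x. \<bar>Y x\<bar> \<partial>Q)"
    using Y_int int_ind[OF Y_int] by (intro integral_mono) (auto simp: indicator_def)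
  finally have "\<bar>(\<Sum>k<m. measure (\<Pi>\<^sub>M i\<in>I. gauss (d k i) (s i)) S) / m - measure Q S\<bar> \<le> sqrt (exp b / m)"
    using EY real_sqrt_le_mono[OF EY2] by linarith
  then show ?thesis unfolding Q_def by (simp add: abs_minus_commute)
qed

section \<open>Approximation by cylinder sets\<close>

text \<open>Induction over the generated sigma-algebra. A single B serves finitely many measures at
  once, because the base law and all components of the mixture must be compared on the same
  cylinder.\<close>

lemma sigma_sets_approx_algebra:
  assumes "algebra \<Omega> \<A>" and "finite I"
    and P: "\<And>i. i \<in> I \<Longrightarrow> finite_measure (P i)" "\<And>i. i \<in> I \<Longrightarrow> sets (P i) = sigma_sets \<Omega> \<A>"
    and "A \<in> sigma_sets \<Omega> \<A>" and "\<tau> > 0"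
  shows "\<exists>B\<in>\<A>. \<forall>i\<in>I. measure (P i) ((A - B) \<union> (B - A)) < \<tau>"
  using assms(5,6)
proof (induction arbitrary: \<tau>)
  interpret algebra \<Omega> \<A> by fact
  note sub = space_closed
  have meas: "X \<in> sets (P i)" if "X \<in> sigma_sets \<Omega> \<A>" "i \<in> I" for X i
    using that P by simp
  {
    case (Basic a)
    then show ?case by (intro bexI[of _ a]) auto
  next
    case Empty
    then show ?case by (intro bexI[of _ "{}"]) auto
  next
    case (Compl a)
    then obtain B where B: "B \<in> \<A>" "\<forall>i\<in>I. measure (P i) ((a - B) \<union> (B - a)) < \<tau>" by blast
    have "a \<subseteq> \<Omega>" "B \<subseteq> \<Omega>" using Compl(1) B(1) sub sigma_sets_into_sp by blast+
    then have "(\<Omega> - a - (\<Omega> - B)) \<union> (\<Omega> - B - (\<Omega> - a)) = (a - B) \<union> (B - a)" by blast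
    then show ?case using B by (intro bexI[of _ "\<Omega> - B"]) auto
  next
    case (Union a)
    have a: "a n \<in> sets (P i)" if "i \<in> I" for i n using Union(1) meas that by blast
    let ?U = "\<Union>n. a n"
    have "\<forall>\<^sub>F n in sequentially. \<forall>i\<in>I. measure (P i) (?U - (\<Union>k<n. a k)) < \<tau> / 2"
    proof (rule eventually_ball_finite[OF assms(2)], rule ballI)
      fix i assume i: "i \<in> I"
      interpret Pi: finite_measure "P i" using P i by simp
      have "(\<lambda>n. measure (P i) (?U - (\<Union>k<n. a k))) \<longlonglongrightarrow> measure (P i) (\<Inter>n. ?U - (\<Union>k<n. a k))"
        using a[OF i] by (intro Pi.finite_Lim_measure_decseq) (auto simp: decseq_def)
      moreover have "(\<Inter>n. ?U - (\<Union>k<n. a k)) = {}" by auto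
      ultimately have "(\<lambda>n. measure (P i) (?U - (\<Union>k<n. a k))) \<longlonglongrightarrow> 0" by (simp only: measure_empty)
      then show "\<forall>\<^sub>F n in sequentially. measure (P i) (?U - (\<Union>k<n. a k)) < \<tau> / 2"
        using Union(3) by (intro order_tendstoD(2)) auto
    qed
    then obtain n where n: "\<forall>i\<in>I. measure (P i) (?U - (\<Union>k<n. a k)) < \<tau> / 2"
      unfolding eventually_sequentially by blast
    \<comment> \<open>The n errors add up to at most \<tau> / 2; \<open>Suc n\<close> keeps the
      divisor positive for n = 0.\<close>
    have "\<exists>B\<in>\<A>. \<forall>i\<in>I. measure (P i) ((a k - B) \<union> (B - a k)) < \<tau> / (2 * Suc n)" for k
      using Union(2)[of "\<tau> / (2 * Suc n)" k] Union(3) by simp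
    then obtain B where B: "\<And>k. B k \<in> \<A>"
      "\<And>k i. i \<in> I \<Longrightarrow> measure (P i) ((a k - B k) \<union> (B k - a k)) < \<tau> / (2 * Suc n)"
      by metis
    let ?B = "\<Union>k<n. B k"
    have BA: "?B \<in> \<A>" using B(1) by (intro finite_UN) auto
    have "measure (P i) ((?U - ?B) \<union> (?B - ?U)) < \<tau>" if i: "i \<in> I" for i
    proof -
      interpret Pi: finite_measure "P i" using P i by simp
      have Bs: "B k \<in> sets (P i)" for k using B(1) i meas by blast
      have "measure (P i) ((?U - ?B) \<union> (?B - ?U)) \<le>
          measure (P i) ((?U - (\<Union>k<n. a k)) \<union> (\<Union>k<n. (a k - B k) \<union> (B k - a k)))"
        using a[OF i] Bs by (intro Pi.finite_measure_mono) auto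
      also have "\<dots> \<le> measure (P i) (?U - (\<Union>k<n. a k)) + measure (P i) (\<Union>k<n. (a k - B k) \<union> (B k - a k))"
        using a[OF i] Bs by (intro measure_Un_le) auto
      also have "measure (P i) (\<Union>k<n. (a k - B k) \<union> (B k - a k)) \<le>
          (\<Sum>k<n. measure (P i) ((a k - B k) \<union> (B k - a k)))"
        using a[OF i] Bs by (intro Pi.finite_measure_subadditive_finite) auto
      also have "\<dots> \<le> (\<Sum>k<n. \<tau> / (2 * Suc n))"
        using B(2)[OF i] by (intro sum_mono less_imp_le) auto
      also have "\<dots> \<le> \<tau> / 2" using Union(3) by (simp add: field_simps)
      finally show ?thesis using n i by force
    qed
    then show ?case using BA by blast
  }
qed

text \<open>The base is an arbitrary measurable set of a finite product rather than a box, which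
  makes the cylinders closed under unions.\<close>

definition cylinders :: "real \<Rightarrow> (real \<Rightarrow> real) set set" where
  "cylinders h = {{y \<in> space (path_space h). restrict y T \<in> S} | T S.
     finite T \<and> T \<subseteq> {-h..1+h} \<and> S \<in> sets (\<Pi>\<^sub>M t\<in>T. borel)}"

lemma path_space_coordinate[measurable]: "t \<in> {-h..1+h} \<Longrightarrow> (\<lambda>y. y t) \<in> borel_measurable (path_space h)"
  unfolding path_space_def by (intro measurable_restrict_space1) measurable

lemma space_path_space:
  "space (path_space h) = {y \<in> extensional {-h..1+h}. continuous_on {-h..1+h} y}"
  unfolding path_space_def by (auto simp: space_restrict_space space_PiM PiE_def)

lemma measurable_into_path_space:
  assumes "\<And>t. t \<in> {-h..1+h} \<Longrightarrow> (\<lambda>\<omega>. f \<omega> t) \<in> borel_measurable M"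
    and "\<And>\<omega>. \<omega> \<in> space M \<Longrightarrow> f \<omega> \<in> extensional {-h..1+h} \<and> continuous_on {-h..1+h} (f \<omega>)"
  shows "f \<in> measurable M (path_space h)"
  unfolding path_space_def
proof (rule measurable_restrict_space2)
  show "f \<in> measurable M (\<Pi>\<^sub>M t\<in>{-h..1+h}. borel)"
    using assms by (intro measurable_PiM_single') (auto simp: PiE_def)
qed (use assms in auto)

lemma measurable_restrict_path:
  "T \<subseteq> {-h..1+h} \<Longrightarrow> (\<lambda>y. restrict y T) \<in> measurable (path_space h) (\<Pi>\<^sub>M t\<in>T. borel)"
  by (rule measurable_restrict, rule path_space_coordinate) auto

lemma cylinders_sets: "cylinders h \<subseteq> sets (path_space h)"
proof
  fix A assume "A \<in> cylinders h"
  then obtain T S where A: "A = {y \<in> space (path_space h). restrict y T \<in> S}"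
    "T \<subseteq> {-h..1+h}" "S \<in> sets (\<Pi>\<^sub>M t\<in>T. borel)" unfolding cylinders_def by blast
  from measurable_sets[OF measurable_restrict_path[OF A(2)] A(3)]
  show "A \<in> sets (path_space h)" unfolding A(1) by (simp add: vimage_def Int_def conj_commute)
qed

lemma sets_path_space_eq: "sets (path_space h) = sigma_sets (space (path_space h)) (cylinders h)"
proof
  have sub: "cylinders h \<subseteq> Pow (space (path_space h))" unfolding cylinders_def by auto
  let ?N = "sigma (space (path_space h)) (cylinders h)"
  have "(\<lambda>y. y) \<in> measurable ?N (path_space h)"
  proof (rule measurable_into_path_space)
    fix t assume t: "t \<in> {-h..1+h}"
    show "(\<lambda>y. y t) \<in> borel_measurable ?N"
    proof (rule measurableI)
      fix B :: "real set" assume B: "B \<in> sets borel"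
      let ?S = "(\<lambda>x. x t) -` B \<inter> space (\<Pi>\<^sub>M t\<in>{t}. (borel :: real measure))"
      have "?S \<in> sets (\<Pi>\<^sub>M t\<in>{t}. borel)"
        using measurable_component_singleton[of t "{t}" "\<lambda>_. borel"] B
        by (intro measurable_sets[where A = borel]) auto
      then have "{y \<in> space (path_space h). restrict y {t} \<in> ?S} \<in> cylinders h"
        unfolding cylinders_def using t by (intro CollectI exI[of _ "{t}"] exI[of _ ?S]) simp
      moreover have "{y \<in> space (path_space h). restrict y {t} \<in> ?S} = (\<lambda>y. y t) -` B \<inter> space ?N"
        using sub by (auto simp: space_PiM space_measure_of)
      ultimately show "(\<lambda>y. y t) -` B \<inter> space ?N \<in> sets ?N" using sub by auto
    qed auto
  qed (use sub in \<open>auto simp: space_path_space space_measure_of\<close>)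
  from measurable_sets[OF this] sub
  show "sets (path_space h) \<subseteq> sigma_sets (space (path_space h)) (cylinders h)"
    by (auto simp: space_measure_of dest: sets.sets_into_space simp: Int_absorb2)
  show "sigma_sets (space (path_space h)) (cylinders h) \<subseteq> sets (path_space h)"
    by (rule sets.sigma_sets_subset[OF cylinders_sets])
qed

lemma algebra_cylinders: "algebra (space (path_space h)) (cylinders h)"
  unfolding algebra_iff_Un
proof (intro conjI ballI)
  show "cylinders h \<subseteq> Pow (space (path_space h))" unfolding cylinders_def by auto
  show "{} \<in> cylinders h" unfolding cylinders_def
    by (intro CollectI exI[of _ "{}"]) simp
next
  fix A assume "A \<in> cylinders h"
  then obtain T S where A: "A = {y \<in> space (path_space h). restrict y T \<in> S}" "finite T"
    "T \<subseteq> {-h..1+h}" "S \<in> sets (\<Pi>\<^sub>M t\<in>T. borel)" unfolding cylinders_def by blast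
  have "space (path_space h) - A =
      {y \<in> space (path_space h). restrict y T \<in> space (\<Pi>\<^sub>M t\<in>T. borel) - S}"
    unfolding A(1) by (auto simp: space_PiM)
  then show "space (path_space h) - A \<in> cylinders h"
    unfolding cylinders_def using A
    by (intro CollectI exI[of _ T] exI[of _ "space (\<Pi>\<^sub>M t\<in>T. borel) - S"]) auto
next
  fix A B assume "A \<in> cylinders h" "B \<in> cylinders h"
  then obtain T S T' S' where A: "A = {y \<in> space (path_space h). restrict y T \<in> S}" "finite T"
    "T \<subseteq> {-h..1+h}" "S \<in> sets (\<Pi>\<^sub>M t\<in>T. borel)"
    and B: "B = {y \<in> space (path_space h). restrict y T' \<in> S'}" "finite T'"
    "T' \<subseteq> {-h..1+h}" "S' \<in> sets (\<Pi>\<^sub>M t\<in>T'. borel)" unfolding cylinders_def by blast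
  let ?M = "\<Pi>\<^sub>M t\<in>T \<union> T'. (borel :: real measure)"
  let ?S = "((\<lambda>y. restrict y T) -` S \<inter> space ?M) \<union> ((\<lambda>y. restrict y T') -` S' \<inter> space ?M)"
  have "?S \<in> sets ?M"
    using A B by (intro sets.Un measurable_sets[of _ ?M] measurable_restrict_subset) auto
  moreover have "A \<union> B = {y \<in> space (path_space h). restrict y (T \<union> T') \<in> ?S}"
    unfolding A(1) B(1) by (auto simp: space_PiM Int_absorb2 Int_commute Int_Un_distrib)
  ultimately show "A \<union> B \<in> cylinders h"
    unfolding cylinders_def using A B by (intro CollectI exI[of _ "T \<union> T'"] exI[of _ ?S]) auto
qed

section \<open>Drifts of Brownian motion\<close>

text \<open>Independence of Brownian increments is stated along infinite increasing sequences of
  times, so a finite grid is continued beyond its maximum.\<close>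

lemma strict_mono_enumeration:
  fixes G :: "real set"
  assumes "finite G"
  shows "\<exists>x :: nat \<Rightarrow> real. strict_mono x \<and> x ` {..<card G} = G"
proof -
  define xs where "xs = sorted_list_of_set G"
  have xs: "sorted_wrt (<) xs" "set xs = G" "length xs = card G"
    using assms by (auto simp: xs_def)
  define x where "x i = (if i < length xs then xs ! i else Max (insert 0 G) + real i + 1)" for i
  have "x i < x (Suc i)" for i
  proof (cases "Suc i < length xs")
    case True
    then show ?thesis using sorted_wrt_nth_less[OF xs(1), of i "Suc i"] by (simp add: x_def)
  next
    case False
    have "xs ! i \<le> Max (insert 0 G)" if "i < length xs"
      using that assms xs(2) nth_mem[OF that] by (intro Max_ge) auto
    then show ?thesis using False by (force simp: x_def)
  qed
  then have "strict_mono x" by (simp add: strict_mono_Suc_iff)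
  moreover have "x ` {..<card G} = G"
    using xs by (force simp: x_def in_set_conv_nth image_iff set_conv_nth)
  ultimately show ?thesis by blast
qed

lemma brownian_increments_law:
  fixes x :: "nat \<Rightarrow> real"
  assumes W: "two_sided_brownian_motion M W" and "s > 0" and x: "strict_mono x" and "0 < n"
  shows "distr M (\<Pi>\<^sub>M i\<in>{..<n}. borel) (\<lambda>\<omega>. \<lambda>i\<in>{..<n}. e i + s * (W (x (Suc i)) \<omega> - W (x i) \<omega>))
    = (\<Pi>\<^sub>M i\<in>{..<n}. gauss (e i) (s * sqrt (x (Suc i) - x i)))"
proof -
  interpret prob_space M using W by (simp add: two_sided_brownian_motion_def)
  have inc: "x i < x (Suc i)" for i using x by (simp add: strict_mono_Suc_iff)
  have W_meas[measurable]: "W t \<in> borel_measurable M" for t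
    using W by (simp add: two_sided_brownian_motion_def)
  let ?X = "\<lambda>i \<omega>. e i + s * (W (x (Suc i)) \<omega> - W (x i) \<omega>)"
  have "indep_vars (\<lambda>_. borel) (\<lambda>i \<omega>. W (x (Suc i)) \<omega> - W (x i) \<omega>) UNIV"
    using W x by (simp add: two_sided_brownian_motion_def)
  then have "indep_vars (\<lambda>_. borel) (\<lambda>i \<omega>. W (x (Suc i)) \<omega> - W (x i) \<omega>) {..<n}"
    by (rule indep_vars_subset) auto
  then have "indep_vars (\<lambda>_. borel) ?X {..<n}"
    by (rule indep_vars_compose2) auto
  moreover have "?X i \<in> borel_measurable M" for i by measurable
  ultimately have "distr M (\<Pi>\<^sub>M i\<in>{..<n}. borel) (\<lambda>\<omega>. \<lambda>i\<in>{..<n}. ?X i \<omega>) = (\<Pi>\<^sub>M i\<in>{..<n}. distr M borel (?X i))"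
    using assms(4) by (subst indep_vars_iff_distr_eq_PiM[symmetric]) auto
  also have "\<dots> = (\<Pi>\<^sub>M i\<in>{..<n}. gauss (e i) (s * sqrt (x (Suc i) - x i)))"
  proof (intro PiM_cong refl)
    fix i
    have "distributed M lborel (\<lambda>\<omega>. W (x (Suc i)) \<omega> - W (x i) \<omega>)
        (\<lambda>y. ennreal (normal_density 0 (sqrt (x (Suc i) - x i)) y))"
      using W inc[of i] by (simp add: two_sided_brownian_motion_def)
    from normal_density_affine[OF this, of s "e i"]
    have "distributed M lborel (?X i) (\<lambda>y. ennreal (normal_density (e i) (s * sqrt (x (Suc i) - x i)) y))"
      using inc[of i] \<open>s > 0\<close> by simp
    then have "distr M lborel (?X i) = gauss (e i) (s * sqrt (x (Suc i) - x i))"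
      unfolding gauss_def by (rule distributed_distr_eq_density)
    then show "distr M borel (?X i) = gauss (e i) (s * sqrt (x (Suc i) - x i))"
      by (simp cong: distr_cong)
  qed
  finally show ?thesis .
qed

text \<open>The data law in terms of the primitive \<open>G\<close> of the regression function,
  which is all that the increments of a path see.\<close>

definition drift_law ::
  "'a measure \<Rightarrow> (real \<Rightarrow> 'a \<Rightarrow> real) \<Rightarrow> real \<Rightarrow> real \<Rightarrow> (real \<Rightarrow> real) \<Rightarrow> (real \<Rightarrow> real) measure" where
  "drift_law M W h s G = distr M (path_space h) (\<lambda>\<omega>. \<lambda>t\<in>{-h..1+h}. G t + s * W t \<omega>)"

lemma measurable_drift_path:
  assumes W: "two_sided_brownian_motion M W" and G: "continuous_on {-h..1+h} G"
  shows "(\<lambda>\<omega>. \<lambda>t\<in>{-h..1+h}. G t + s * W t \<omega>) \<in> measurable M (path_space h)"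
proof (rule measurable_into_path_space)
  fix t assume t: "t \<in> {-h..1+h}"
  have [measurable]: "W t \<in> borel_measurable M" using W by (simp add: two_sided_brownian_motion_def)
  have "(\<lambda>\<omega>. G t + s * W t \<omega>) \<in> borel_measurable M" by measurable
  then show "(\<lambda>\<omega>. (\<lambda>t\<in>{-h..1+h}. G t + s * W t \<omega>) t) \<in> borel_measurable M" using t by simp
next
  fix \<omega> assume "\<omega> \<in> space M"
  then have "continuous_on UNIV (\<lambda>t. W t \<omega>)" using W by (simp add: two_sided_brownian_motion_def)
  then have "continuous_on {-h..1+h} (\<lambda>t. G t + s * W t \<omega>)"
    using G by (intro continuous_intros) (auto intro: continuous_on_subset)
  then have "continuous_on {-h..1+h} (\<lambda>t\<in>{-h..1+h}. G t + s * W t \<omega>)"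
    by (rule continuous_on_eq) simp
  then show "(\<lambda>t\<in>{-h..1+h}. G t + s * W t \<omega>) \<in> extensional {-h..1+h} \<and>
      continuous_on {-h..1+h} (\<lambda>t\<in>{-h..1+h}. G t + s * W t \<omega>)" by simp
qed

lemma prob_space_drift_law:
  assumes W: "two_sided_brownian_motion M W" and G: "continuous_on {-h..1+h} G"
  shows "prob_space (drift_law M W h s G)"
proof -
  interpret prob_space M using W by (simp add: two_sided_brownian_motion_def)
  show ?thesis unfolding drift_law_def by (rule prob_space_distr[OF measurable_drift_path[OF assms]])
qed

text \<open>One \<open>S'\<close> serves all \<open>E\<close>: the path at the grid times is
  recovered from its increments, \<open>G\<close> is a known translation, and \<open>E\<close> only
  shifts the means of the increments. This turns a statement about path laws into one about shifted
  Gaussian vectors.\<close>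

lemma drift_law_cylinder:
  assumes W: "two_sided_brownian_motion M W" and "s > 0" and G: "continuous_on {-h..1+h} G"
    and x: "strict_mono x" and "0 < n"
    and T: "finite T" "T \<subseteq> {-h..1+h}" "T \<subseteq> x ` {..n}" and zero: "0 \<in> x ` {..n}"
    and S: "S \<in> sets (\<Pi>\<^sub>M t\<in>T. borel)"
  obtains S' where "S' \<in> sets (\<Pi>\<^sub>M i\<in>{..<n}. borel)"
    "\<And>E. E 0 = 0 \<Longrightarrow> continuous_on {-h..1+h} E \<Longrightarrow>
      measure (drift_law M W h s (\<lambda>t. G t + E t)) {y \<in> space (path_space h). restrict y T \<in> S}
      = measure (\<Pi>\<^sub>M i\<in>{..<n}. gauss (E (x (Suc i)) - E (x i)) (s * sqrt (x (Suc i) - x i))) S'"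
proof -
  interpret prob_space M using W by (simp add: two_sided_brownian_motion_def)
  have W_meas[measurable]: "W t \<in> borel_measurable M" for t
    using W by (simp add: two_sided_brownian_motion_def)
  have "\<forall>t\<in>T. \<exists>j. j \<le> n \<and> x j = t" using T(3) by fastforce
  then obtain idx where idx: "\<And>t. t \<in> T \<Longrightarrow> idx t \<le> n \<and> x (idx t) = t"
    unfolding bchoice_iff by blast
  obtain i0 where i0: "i0 \<le> n" "x i0 = 0" using zero by auto
  let ?M = "\<Pi>\<^sub>M i\<in>{..<n}. (borel :: real measure)"
  \<comment> \<open>Times may be negative, so partial sums are anchored at the index
    \<open>i0\<close> of time 0, where \<open>W\<close> and \<open>E\<close> vanish.\<close>
  define \<Psi> where "\<Psi> u = (\<lambda>t\<in>T. G t + (\<Sum>i<idx t. u i) - (\<Sum>i<i0. u i))" for u :: "nat \<Rightarrow> real"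
  have \<Psi>_meas: "\<Psi> \<in> measurable ?M (\<Pi>\<^sub>M t\<in>T. borel)"
    unfolding \<Psi>_def[abs_def]
  proof (rule measurable_restrict)
    fix t assume t: "t \<in> T"
    have "(\<lambda>u. u i) \<in> borel_measurable ?M" if "i < n" for i
      using measurable_component_singleton[of i "{..<n}" "\<lambda>_. borel"] that by simp
    then show "(\<lambda>u. G t + (\<Sum>i<idx t. u i) - (\<Sum>i<i0. u i)) \<in> borel_measurable ?M"
      using idx[OF t] i0(1)
      by (intro borel_measurable_add borel_measurable_diff borel_measurable_sum borel_measurable_const) auto
  qed
  let ?S' = "\<Psi> -` S \<inter> space ?M"
  have S': "?S' \<in> sets ?M" using \<Psi>_meas S by (rule measurable_sets)
  have "measure (drift_law M W h s (\<lambda>t. G t + E t)) {y \<in> space (path_space h). restrict y T \<in> S}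
      = measure (\<Pi>\<^sub>M i\<in>{..<n}. gauss (E (x (Suc i)) - E (x i)) (s * sqrt (x (Suc i) - x i))) ?S'"
    if E: "E 0 = 0" "continuous_on {-h..1+h} E" for E
  proof -
    let ?A = "{y \<in> space (path_space h). restrict y T \<in> S}"
    let ?X = "\<lambda>\<omega>. \<lambda>i\<in>{..<n}. (E (x (Suc i)) - E (x i)) + s * (W (x (Suc i)) \<omega> - W (x i) \<omega>)"
    let ?Y = "\<lambda>\<omega>. \<lambda>t\<in>{-h..1+h}. G t + E t + s * W t \<omega>"
    have Y: "?Y \<in> measurable M (path_space h)"
      by (rule measurable_drift_path[OF W continuous_on_add[OF G E(2)]])
    have A: "?A \<in> sets (path_space h)"
      using cylinders_sets[of h] T S by (auto simp: cylinders_def)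
    have X: "?X \<in> measurable M ?M" by (rule measurable_restrict) measurable
    have eq: "restrict (?Y \<omega>) T = \<Psi> (?X \<omega>)" if \<omega>: "\<omega> \<in> space M" for \<omega>
    proof
      fix t
      have W0: "W 0 \<omega> = 0" using W \<omega> by (simp add: two_sided_brownian_motion_def)
      have tele: "(\<Sum>i<j. ?X \<omega> i) = (E (x j) + s * W (x j) \<omega>) - (E (x 0) + s * W (x 0) \<omega>)" if "j \<le> n" for j
      proof -
        have "(\<Sum>i<j. ?X \<omega> i) = (\<Sum>i<j. (E (x (Suc i)) + s * W (x (Suc i)) \<omega>) - (E (x i) + s * W (x i) \<omega>))"
          using that by (intro sum.cong) (auto simp: algebra_simps)
        then show ?thesis
          using sum_lessThan_telescope[of "\<lambda>i. E (x i) + s * W (x i) \<omega>" j] by simp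
      qed
      show "restrict (?Y \<omega>) T t = \<Psi> (?X \<omega>) t"
      proof (cases "t \<in> T")
        case True
        then have "t \<in> {-h..1+h}" using T(2) by blast
        moreover have "\<Psi> (?X \<omega>) t = G t + (\<Sum>i<idx t. ?X \<omega> i) - (\<Sum>i<i0. ?X \<omega> i)"
          unfolding \<Psi>_def using True by (rule restrict_apply')
        moreover have "\<dots> = G t + E t + s * W t \<omega>"
          using idx[OF True] i0 W0 E(1) by (simp only: tele)
        ultimately show ?thesis using True by simp
      qed (simp add: \<Psi>_def)
    qed
    have "measure (drift_law M W h s (\<lambda>t. G t + E t)) ?A = measure M (?Y -` ?A \<inter> space M)"
      unfolding drift_law_def by (rule measure_distr[OF Y A])
    also have "?Y -` ?A \<inter> space M = ?X -` ?S' \<inter> space M"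
    proof -
      have "?Y \<omega> \<in> ?A \<longleftrightarrow> ?X \<omega> \<in> ?S'" if \<omega>: "\<omega> \<in> space M" for \<omega>
        using measurable_space[OF Y \<omega>] measurable_space[OF X \<omega>] eq[OF \<omega>]
        by (simp only: mem_Collect_eq vimage_eq Int_iff simp_thms)
      then show ?thesis by blast
    qed
    also have "measure M (?X -` ?S' \<inter> space M) = measure (distr M ?M ?X) ?S'"
      by (rule measure_distr[OF X S', symmetric])
    also have "distr M ?M ?X = (\<Pi>\<^sub>M i\<in>{..<n}. gauss (E (x (Suc i)) - E (x i)) (s * sqrt (x (Suc i) - x i)))"
      by (rule brownian_increments_law[OF W \<open>s > 0\<close> x \<open>0 < n\<close>])
    finally show ?thesis .
  qed
  with S' that show ?thesis by blast
qed

text \<open>Invariance of a function under \<open>clamp_to u v\<close> says that it is constant on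
  either side of [u, v], that is, that its derivative lives inside.\<close>

definition clamp_to :: "real \<Rightarrow> real \<Rightarrow> real \<Rightarrow> real" where
  "clamp_to u v t = max u (min v t)"

text \<open>On a grid through all p k each cell meets at most one interval [p k, p (k+1)] in more
  than an endpoint, so the increments of different \<open>E k\<close> are orthogonal. The discrete
  Cameron-Martin norm of one \<open>E k\<close> is at most a^2 w / s^2 on every grid, which permits
  passing from cylinders to all events.\<close>

lemma drift_mixture_distance:
  fixes p :: "nat \<Rightarrow> real" and E :: "nat \<Rightarrow> real \<Rightarrow> real"
  assumes W: "two_sided_brownian_motion M W" and "s > 0" and G: "continuous_on {-h..1+h} G" and "m > 0"
    and p: "\<And>k. k < m \<Longrightarrow> p k \<le> p (Suc k)" "\<And>k. k < m \<Longrightarrow> p (Suc k) - p k \<le> w"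
    and E0: "\<And>k. E k 0 = 0"
    and lip: "\<And>k t u. \<bar>E k t - E k u\<bar> \<le> a * \<bar>t - u\<bar>"
    and cl: "\<And>k t. E k t = E k (clamp_to (p k) (p (Suc k)) t)"
    and A: "A \<in> sets (path_space h)"
  shows "\<bar>measure (drift_law M W h s G) A - (\<Sum>k<m. measure (drift_law M W h s (\<lambda>t. G t + E k t)) A) / m\<bar>
    \<le> sqrt (exp (a\<^sup>2 * w / s\<^sup>2) / m)"
proof -
  let ?b = "sqrt (exp (a\<^sup>2 * w / s\<^sup>2) / m)"
  have a: "a \<ge> 0" using order_trans[OF abs_ge_zero lip[of 0 1 0]] by simp
  have p_mono: "p i \<le> p j" if "i \<le> j" "j \<le> m" for i j
    using that
  proof (induction rule: dec_induct)
    case (step n)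
    then show ?case using p(1)[of n] by simp
  qed simp
  have E_cont: "continuous_on X (E k)" for k X
  proof (rule lipschitz_on_continuous_on)
    show "a-lipschitz_on X (E k)" using lip a by (intro lipschitz_onI) (simp_all add: dist_real_def)
  qed
  have cyl: "\<bar>measure (drift_law M W h s G) B - (\<Sum>k<m. measure (drift_law M W h s (\<lambda>t. G t + E k t)) B) / m\<bar> \<le> ?b"
    if B_cyl: "B \<in> cylinders h" for B
  proof -
    obtain T S where B: "B = {y \<in> space (path_space h). restrict y T \<in> S}" and T: "finite T"
      "T \<subseteq> {-h..1+h}" and S: "S \<in> sets (\<Pi>\<^sub>M t\<in>T. borel)" using B_cyl unfolding cylinders_def by blast
    \<comment> \<open>The point 0 anchors the path, 0 and 1 together guarantee at least one cell,
      and the p k make the cells respect the supports.\<close>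
    let ?G = "T \<union> {0, 1} \<union> p ` {..m}"
    obtain x where x: "strict_mono x" "x ` {..<card ?G} = ?G"
      using strict_mono_enumeration[of ?G] T(1) by auto
    have "card {0, 1::real} \<le> card ?G" using T(1) by (intro card_mono) auto
    then obtain n where n: "card ?G = Suc n" "0 < n" by (cases "card ?G") auto
    have xG: "x ` {..n} = ?G" using x(2) n(1) by (simp add: lessThan_Suc_atMost)
    have inc: "x i < x (Suc i)" for i using x by (simp add: strict_mono_Suc_iff)
    obtain S' where S': "S' \<in> sets (\<Pi>\<^sub>M i\<in>{..<n}. borel)"
      and law: "\<And>E. E 0 = 0 \<Longrightarrow> continuous_on {-h..1+h} E \<Longrightarrow>
      measure (drift_law M W h s (\<lambda>t. G t + E t)) B
      = measure (\<Pi>\<^sub>M i\<in>{..<n}. gauss (E (x (Suc i)) - E (x i)) (s * sqrt (x (Suc i) - x i))) S'"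
      unfolding B by (rule drift_law_cylinder[OF W \<open>s > 0\<close> G x(1) n(2) T _ _ S]) (use xG in auto)
    let ?\<Delta> = "\<lambda>i. x (Suc i) - x i"
    let ?c = "\<lambda>k i. clamp_to (p k) (p (Suc k)) (x i)"
    have sd: "(s * sqrt (?\<Delta> i))\<^sup>2 = s\<^sup>2 * ?\<Delta> i" for i
      using inc[of i] by (simp add: power_mult_distrib)
    have le: "\<bar>E k (x (Suc i)) - E k (x i)\<bar> \<le> a * (?c k (Suc i) - ?c k i)" for k i
      using lip[of k "?c k (Suc i)" "?c k i"] cl[of k "x (Suc i)"] cl[of k "x i"] inc[of i]
      by (auto simp: clamp_to_def)
    have c_le: "?c k (Suc i) - ?c k i \<le> ?\<Delta> i" "0 \<le> ?c k (Suc i) - ?c k i" if "k < m" for k i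
      using inc[of i] p(1)[OF that] by (auto simp: clamp_to_def max_def min_def)
    have disjoint: "?c k (Suc i) = ?c k i \<or> ?c l (Suc i) = ?c l i" if "k < l" "l < m" "i < n" for k l i
    proof -
      have "Suc k \<le> m" "Suc k \<le> l" using that by auto
      have "p (Suc k) \<in> x ` {..n}" unfolding xG using \<open>Suc k \<le> m\<close> by auto
      then obtain j where j: "j \<le> n" "x j = p (Suc k)" by auto
      have "p (Suc k) \<le> p l" using p_mono[OF \<open>Suc k \<le> l\<close>] that by simp
      show ?thesis
      proof (cases "j \<le> i")
        case True
        then have "p (Suc k) \<le> x i" using x(1) j by (metis strict_mono_less_eq)
        then show ?thesis using inc[of i] by (auto simp: clamp_to_def)
      next
        case False
        then have "x (Suc i) \<le> p (Suc k)" using x(1) j by (metis strict_mono_less_eq not_less_eq_eq)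
        then show ?thesis using inc[of i] \<open>p (Suc k) \<le> p l\<close> by (auto simp: clamp_to_def)
      qed
    qed
    have "\<bar>measure (\<Pi>\<^sub>M i\<in>{..<n}. gauss 0 (s * sqrt (?\<Delta> i))) S' -
        (\<Sum>k<m. measure (\<Pi>\<^sub>M i\<in>{..<n}. gauss (E k (x (Suc i)) - E k (x i)) (s * sqrt (?\<Delta> i))) S') / m\<bar>
      \<le> ?b"
    proof (rule gauss_mixture_distance[OF _ _ \<open>m > 0\<close> _ _ S'])
      show "0 < s * sqrt (?\<Delta> i)" for i using inc[of i] \<open>s > 0\<close> by simp
    next
      fix k l assume kl: "k < m" "l < m" "k \<noteq> l"
      have "(E k (x (Suc i)) - E k (x i)) * (E l (x (Suc i)) - E l (x i)) = 0" if "i \<in> {..<n}" for i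
      proof -
        have "?c k (Suc i) = ?c k i \<or> ?c l (Suc i) = ?c l i"
          using disjoint[of k l i] disjoint[of l k i] kl that by (cases "k < l") auto
        then show ?thesis using le[of k i] le[of l i] by auto
      qed
      then show "(\<Sum>i<n. (E k (x (Suc i)) - E k (x i)) * (E l (x (Suc i)) - E l (x i)) / (s * sqrt (?\<Delta> i))\<^sup>2) = 0"
        by (intro sum.neutral) auto
    next
      fix k assume k: "k < m"
      \<comment> \<open>Of the two factors in the squared clamped length one is enlarged to the cell
        length, which the variance cancels; the other telescopes over the grid.\<close>
      have "(E k (x (Suc i)) - E k (x i))\<^sup>2 / (s * sqrt (?\<Delta> i))\<^sup>2 \<le> a\<^sup>2 / s\<^sup>2 * (?c k (Suc i) - ?c k i)" for i
      proof -
        let ?d = "?c k (Suc i) - ?c k i"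
        have "(E k (x (Suc i)) - E k (x i))\<^sup>2 \<le> (a * ?d)\<^sup>2"
          using le[of k i] by (metis abs_ge_zero power2_abs power_mono)
        also have "\<dots> = a\<^sup>2 * (?d * ?d)" by (simp add: power_mult_distrib power2_eq_square)
        also have "\<dots> \<le> a\<^sup>2 * (?\<Delta> i * ?d)"
          using c_le[OF k, of i] by (intro mult_left_mono mult_right_mono) auto
        finally have "(E k (x (Suc i)) - E k (x i))\<^sup>2 / (s\<^sup>2 * ?\<Delta> i) \<le> a\<^sup>2 * (?\<Delta> i * ?d) / (s\<^sup>2 * ?\<Delta> i)"
          using inc[of i] \<open>s > 0\<close> by (intro divide_right_mono) auto
        also have "\<dots> = a\<^sup>2 / s\<^sup>2 * ?d" using inc[of i] \<open>s > 0\<close> by (simp add: field_simps)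
        finally show ?thesis by (simp only: sd)
      qed
      then have "(\<Sum>i<n. (E k (x (Suc i)) - E k (x i))\<^sup>2 / (s * sqrt (?\<Delta> i))\<^sup>2)
          \<le> (\<Sum>i<n. a\<^sup>2 / s\<^sup>2 * (?c k (Suc i) - ?c k i))" by (intro sum_mono)
      also have "\<dots> = a\<^sup>2 / s\<^sup>2 * (?c k n - ?c k 0)"
        using sum_lessThan_telescope[of "?c k" n] by (simp only: sum_distrib_left[symmetric])
      also have "\<dots> \<le> a\<^sup>2 / s\<^sup>2 * w"
        using p[OF k] by (intro mult_left_mono) (auto simp: clamp_to_def max_def min_def)
      finally show "(\<Sum>i<n. (E k (x (Suc i)) - E k (x i))\<^sup>2 / (s * sqrt (?\<Delta> i))\<^sup>2) \<le> a\<^sup>2 * w / s\<^sup>2" by simp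
    qed auto
    moreover have "measure (drift_law M W h s G) B = measure (\<Pi>\<^sub>M i\<in>{..<n}. gauss 0 (s * sqrt (?\<Delta> i))) S'"
      using law[of "\<lambda>_. 0"] by simp
    moreover have "measure (drift_law M W h s (\<lambda>t. G t + E k t)) B =
        measure (\<Pi>\<^sub>M i\<in>{..<n}. gauss (E k (x (Suc i)) - E k (x i)) (s * sqrt (?\<Delta> i))) S'" for k
      by (rule law[OF E0 E_cont])
    ultimately show ?thesis by simp
  qed
  \<comment> \<open>The base law gets the index m, so that one approximating cylinder is obtained
    for it and for all components.\<close>
  define P where "P k = (if k < m then drift_law M W h s (\<lambda>t. G t + E k t) else drift_law M W h s G)" for k
  have P: "prob_space (P k)" for k
    unfolding P_def using prob_space_drift_law[OF W G] prob_space_drift_law[OF W continuous_on_add[OF G E_cont]] by auto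
  have P_sets: "sets (P k) = sets (path_space h)" for k by (simp add: P_def drift_law_def)
  have "\<bar>measure (P m) A - (\<Sum>k<m. measure (P k) A) / m\<bar> \<le> ?b"
  proof (rule field_le_epsilon)
    fix \<tau> :: real assume "\<tau> > 0"
    then have "\<tau> / 2 > 0" by simp
    have "\<exists>B\<in>cylinders h. \<forall>k\<in>{..m}. measure (P k) ((A - B) \<union> (B - A)) < \<tau> / 2"
      using sigma_sets_approx_algebra[OF algebra_cylinders, of "{..m}" P h A, OF _ _ _ _ \<open>\<tau> / 2 > 0\<close>] P_sets A P
      by (simp add: sets_path_space_eq[symmetric] prob_space.finite_measure)
    then obtain B where B: "B \<in> cylinders h" "\<And>k. k \<le> m \<Longrightarrow> measure (P k) ((A - B) \<union> (B - A)) < \<tau> / 2" by auto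
    have AB: "\<bar>measure (P k) A - measure (P k) B\<bar> \<le> \<tau> / 2" if "k \<le> m" for k
    proof -
      interpret prob_space "P k" by (rule P)
      have sets: "A \<in> events" "B \<in> events" using A B(1) cylinders_sets by (auto simp: P_sets)
      have "prob A \<le> prob (B \<union> ((A - B) \<union> (B - A)))" "prob B \<le> prob (A \<union> ((A - B) \<union> (B - A)))"
        using sets by (intro finite_measure_mono; auto)+
      moreover have "prob (B \<union> ((A - B) \<union> (B - A))) \<le> prob B + prob ((A - B) \<union> (B - A))"
        "prob (A \<union> ((A - B) \<union> (B - A))) \<le> prob A + prob ((A - B) \<union> (B - A))"
        using sets by (intro measure_Un_le; auto)+
      ultimately show ?thesis using B(2)[OF that] by linarith
    qed
    have "\<bar>(\<Sum>k<m. measure (P k) A) - (\<Sum>k<m. measure (P k) B)\<bar> \<le> (\<Sum>k<m. \<tau> / 2)"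
      unfolding sum_subtractf[symmetric] using AB by (intro order_trans[OF sum_abs sum_mono]) auto
    then have "\<bar>(\<Sum>k<m. measure (P k) A) - (\<Sum>k<m. measure (P k) B)\<bar> / m \<le> (m * (\<tau> / 2)) / m"
      by (intro divide_right_mono) auto
    then have avg: "\<bar>(\<Sum>k<m. measure (P k) A) / m - (\<Sum>k<m. measure (P k) B) / m\<bar> \<le> \<tau> / 2"
      using \<open>m > 0\<close> by (simp add: diff_divide_distrib[symmetric])
    have "\<bar>measure (P m) B - (\<Sum>k<m. measure (P k) B) / m\<bar> \<le> ?b"
      using cyl[OF B(1)] by (simp add: P_def)
    with avg AB[OF order_refl] show "\<bar>measure (P m) A - (\<Sum>k<m. measure (P k) A) / m\<bar> \<le> ?b + \<tau>"
      by linarith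
  qed
  then show ?thesis by (simp add: P_def)
qed

section \<open>Short bands separate\<close>

lemma interval_length_ge:
  assumes "u \<in> A" "u + L \<in> A"
  shows "ereal L \<le> interval_length A"
proof -
  have "ereal L = ereal (u + L) - ereal u" by simp
  also have "\<dots> \<le> (SUP z\<in>A. ereal z) - (INF z\<in>A. ereal z)"
    using assms by (intro ereal_minus_mono SUP_upper INF_lower)
  finally show ?thesis using assms by (auto simp: interval_length_def)
qed

text \<open>If the band were shorter than \<open>L\<close> then, on the event that it covers \<open>f\<close>, it could cover none of the
  perturbations of \<open>f\<close>; this event would distinguish \<open>P f\<close> from the mixture of the \<open>P (g k)\<close>.\<close>

lemma band_risk_ge:
  fixes g :: "nat \<Rightarrow> real \<Rightarrow> real"
  assumes C: "C \<in> covering_bands P h \<alpha> F"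
    and P: "\<And>f'. f' \<in> insert f (g ` {..<m}) \<Longrightarrow> prob_space (P f')"
      "\<And>f'. sets (P f') = sets (path_space h)"
    and f: "f \<in> F" "f \<in> G" and g: "\<And>k. k < m \<Longrightarrow> g k \<in> F"
    and x: "\<And>k. k < m \<Longrightarrow> x k \<in> {0..1}" "\<And>k. k < m \<Longrightarrow> g k (x k) = f (x k) + L" and "m > 0"
    and dist: "\<And>A. A \<in> sets (path_space h) \<Longrightarrow>
      \<bar>measure (P f) A - (\<Sum>k<m. measure (P (g k)) A) / m\<bar> \<le> b"
    and b: "b < \<beta> - 2 * \<alpha>"
  shows "ereal L \<le> band_risk P \<beta> C G"
proof (rule ccontr)
  assume "\<not> ereal L \<le> band_risk P \<beta> C G"
  moreover have "quantile (P f) \<beta> (max_length C) \<le> band_risk P \<beta> C G"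
    unfolding band_risk_def using f(2) by (rule SUP_upper)
  ultimately have "quantile (P f) \<beta> (max_length C) < ereal L" by simp
  then obtain q where q: "q < ereal L" "\<beta> \<le> measure (P f) {y \<in> space (P f). max_length C y \<le> q}"
    unfolding quantile_def by (auto simp: Inf_less_iff)
  have band: "confidence_band h F C"
    and cov: "\<And>f. f \<in> F \<Longrightarrow> 1 - \<alpha> \<le> measure (P f) (coverage_event h C f)"
  proof -
    show "confidence_band h F C" using C by (simp add: covering_bands_def)
    fix f assume "f \<in> F"
    then have "ereal (1 - \<alpha>) \<le> ereal (measure (P f) (coverage_event h C f))"
      using C by (auto simp: covering_bands_def le_INF_iff)
    then show "1 - \<alpha> \<le> measure (P f) (coverage_event h C f)" by simp
  qed
  have cov_sets: "coverage_event h C f \<in> sets (path_space h)" if "f \<in> F" for f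
    using band that by (simp add: confidence_band_def)
  have spaceP: "space (P f) = space (path_space h)" for f
    using P(2) by (rule sets_eq_imp_space_eq)
  define E where "E = {y \<in> space (path_space h). max_length C y \<le> q}"
  have [measurable]: "max_length C \<in> borel_measurable (path_space h)"
    using band by (simp add: confidence_band_def)
  have E: "E \<in> sets (path_space h)" unfolding E_def by measurable
  define A where "A = E \<inter> coverage_event h C f"
  have A: "A \<in> sets (path_space h)" unfolding A_def using E cov_sets[OF f(1)] by blast
  \<comment> \<open>Under \<open>P f\<close> the band is short with probability at least \<beta> and
    misses \<open>f\<close> with probability at most \<alpha>. As \<open>A\<close> has probability
    at most \<alpha> under each \<open>P (g k)\<close>, the gap is \<beta> - 2 \<alpha>.\<close>
  have "\<beta> - \<alpha> \<le> measure (P f) A"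
  proof -
    interpret prob_space "P f" by (rule P(1)) simp
    have ev: "E \<in> events" "coverage_event h C f \<in> events"
      using E cov_sets[OF f(1)] P(2) by auto
    have "prob E \<le> prob (A \<union> (space (P f) - coverage_event h C f))"
      using ev A P(2) by (intro finite_measure_mono) (auto simp: A_def E_def spaceP)
    also have "\<dots> \<le> prob A + prob (space (P f) - coverage_event h C f)"
      using ev A P(2) by (intro measure_Un_le) auto
    also have "\<dots> = prob A + 1 - prob (coverage_event h C f)" using ev by (simp add: prob_compl)
    finally show ?thesis using cov[OF f(1)] q(2) by (simp add: E_def spaceP)
  qed
  moreover have "measure (P (g k)) A \<le> \<alpha>" if k: "k < m" for k
  proof -
    interpret prob_space "P (g k)" using P(1) k by simp
    have ev: "coverage_event h C (g k) \<in> events" using cov_sets[OF g[OF k]] P(2) by auto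
    have "A \<inter> coverage_event h C (g k) = {}"
    proof (rule ccontr)
      assume "A \<inter> coverage_event h C (g k) \<noteq> {}"
      then obtain y where "y \<in> A" "y \<in> coverage_event h C (g k)" by blast
      then have y: "max_length C y \<le> q" "f (x k) \<in> C y (x k)" "g k (x k) \<in> C y (x k)"
        using x(1)[OF k] unfolding A_def E_def coverage_event_def by blast+
      have "ereal L \<le> interval_length (C y (x k))"
        using y x(2)[OF k] by (intro interval_length_ge[of "f (x k)"]) auto
      also have "\<dots> \<le> max_length C y" unfolding max_length_def using x(1)[OF k] by (rule SUP_upper)
      finally show False using y(1) q(1) by auto
    qed
    then have "prob A \<le> prob (space (P (g k)) - coverage_event h C (g k))"
      using ev A P(2) sets.sets_into_space[OF A]
      by (intro finite_measure_mono) (auto simp: spaceP)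
    also have "\<dots> = 1 - prob (coverage_event h C (g k))" using ev by (simp add: prob_compl)
    finally show ?thesis using cov[OF g[OF k]] by simp
  qed
  then have "(\<Sum>k<m. measure (P (g k)) A) \<le> (\<Sum>k<m. \<alpha>)" by (intro sum_mono) auto
  then have "(\<Sum>k<m. measure (P (g k)) A) / m \<le> \<alpha>" using \<open>m > 0\<close> by (simp add: field_simps)
  ultimately show False using dist[OF A] b by linarith
qed

section \<open>Primitives of regression functions and the laws of the data\<close>

lemma DERIV_primitive:
  fixes f :: "real \<Rightarrow> real"
  assumes "continuous_on UNIV f"
  shows "((\<lambda>t. LBINT u=0..t. f u) has_real_derivative f x) (at x)"
proof -
  have "((\<lambda>t. LBINT u=ereal 0..t. f u) has_vector_derivative f x) (at x within {-\<bar>x\<bar>-1..\<bar>x\<bar>+1})"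
    by (rule interval_integral_FTC2) (auto intro: continuous_on_subset[OF assms])
  moreover have "at x within {-\<bar>x\<bar>-1..\<bar>x\<bar>+1} = at x"
    by (rule at_within_interior) (auto simp: interior_atLeastAtMost_real)
  ultimately show ?thesis
    by (simp add: has_real_derivative_iff_has_vector_derivative zero_ereal_def)
qed

text \<open>Both sides have the same derivative and agree at 0, which avoids a case distinction on
  the sign of t.\<close>

lemma primitive_add:
  fixes f g :: "real \<Rightarrow> real"
  assumes "continuous_on UNIV f" "continuous_on UNIV g"
  shows "(LBINT u=0..ereal t. f u + g u) = (LBINT u=0..ereal t. f u) + (LBINT u=0..ereal t. g u)"
proof -
  let ?h = "\<lambda>t. (LBINT u=0..ereal t. f u + g u) - ((LBINT u=0..ereal t. f u) + (LBINT u=0..ereal t. g u))"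
  have "(?h has_real_derivative (f x + g x) - (f x + g x)) (at x)" for x
    by (intro DERIV_diff DERIV_add DERIV_primitive assms continuous_on_add)
  then have "?h t = ?h 0" by (intro DERIV_isconst_all) simp
  then show ?thesis by (simp add: zero_ereal_def[symmetric])
qed

lemma primitive_lipschitz:
  fixes f :: "real \<Rightarrow> real"
  assumes "continuous_on UNIV f" "\<And>x. \<bar>f x\<bar> \<le> B"
  shows "\<bar>(LBINT u=0..ereal t. f u) - (LBINT u=0..ereal s. f u)\<bar> \<le> B * \<bar>t - s\<bar>"
  using field_differentiable_bound[of UNIV "\<lambda>t. LBINT u=0..ereal t. f u" f B t s]
    DERIV_primitive[OF assms(1)] assms(2) by auto

lemma primitive_clamp:
  fixes f :: "real \<Rightarrow> real"
  assumes "continuous_on UNIV f" "\<And>x. x \<le> p \<or> p' \<le> x \<Longrightarrow> f x = 0" "p \<le> p'"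
  shows "(LBINT u=0..ereal t. f u) = (LBINT u=0..ereal (clamp_to p p' t). f u)"
proof -
  let ?F = "\<lambda>t. LBINT u=0..ereal t. f u"
  have const: "?F b = ?F a" if "a \<le> b" "\<And>x. a < x \<Longrightarrow> x < b \<Longrightarrow> f x = 0" for a b
  proof (cases "a = b")
    case False
    then have "a < b" using that by simp
    then show ?thesis
    proof (rule DERIV_isconst_end)
      show "continuous_on {a..b} ?F"
        using DERIV_primitive[OF assms(1)] by (meson DERIV_isCont continuous_at_imp_continuous_on)
      show "(?F has_real_derivative 0) (at x)" if "a < x" "x < b" for x
        using DERIV_primitive[OF assms(1), of x] \<open>\<And>x. a < x \<Longrightarrow> x < b \<Longrightarrow> f x = 0\<close>[OF that] by simp
    qed
  qed simp
  consider "t < p" | "p \<le> t" "t \<le> p'" | "p' < t" by linarith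
  then show ?thesis
  proof cases
    case 1
    then have "?F p = ?F t" by (intro const assms) auto
    then show ?thesis using 1 assms(3) by (simp add: clamp_to_def)
  next
    case 3
    then have "?F t = ?F p'" by (intro const assms) auto
    then show ?thesis using 3 assms(3) by (simp add: clamp_to_def)
  qed (simp add: clamp_to_def)
qed

lemma data_law_eq_drift_law: "data_law M W h s f = drift_law M W h s (\<lambda>t. LBINT u=0..t. f u)"
  unfolding data_law_def drift_law_def observation_def ..

lemma data_law_mixture_distance:
  fixes g :: "nat \<Rightarrow> real \<Rightarrow> real" and p :: "nat \<Rightarrow> real"
  assumes W: "two_sided_brownian_motion M W" and "s > 0" "m > 0"
    and f: "continuous_on UNIV f" and g: "\<And>k. continuous_on UNIV (g k)" "\<And>k x. \<bar>g k x\<bar> \<le> a"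
    and p: "\<And>k. p k \<le> p (Suc k)" "\<And>k. p (Suc k) - p k \<le> w"
    and supp: "\<And>k x. x \<le> p k \<or> p (Suc k) \<le> x \<Longrightarrow> g k x = 0"
    and A: "A \<in> sets (path_space h)"
  shows "\<bar>measure (data_law M W h s f) A - (\<Sum>k<m. measure (data_law M W h s (\<lambda>x. f x + g k x)) A) / m\<bar>
    \<le> sqrt (exp (a\<^sup>2 * w / s\<^sup>2) / m)"
proof -
  have "continuous_on {-h..1+h} (\<lambda>t. LBINT u=0..ereal t. f u)"
    using DERIV_primitive[OF f] by (meson DERIV_isCont continuous_at_imp_continuous_on)
  from W \<open>s > 0\<close> this \<open>m > 0\<close> p
  have "\<bar>measure (drift_law M W h s (\<lambda>t. LBINT u=0..ereal t. f u)) A - (\<Sum>k<m. measure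
      (drift_law M W h s (\<lambda>t. (LBINT u=0..ereal t. f u) + (LBINT u=0..ereal t. g k u))) A) / m\<bar>
    \<le> sqrt (exp (a\<^sup>2 * w / s\<^sup>2) / m)"
  proof (rule drift_mixture_distance)
    fix k t u
    show "\<bar>(LBINT u=0..ereal t. g k u) - (LBINT v=0..ereal u. g k v)\<bar> \<le> a * \<bar>t - u\<bar>"
      using g by (rule primitive_lipschitz)
    show "(LBINT u=0..ereal t. g k u) = (LBINT u=0..ereal (clamp_to (p k) (p (Suc k)) t). g k u)"
      using g(1) supp p(1) by (rule primitive_clamp)
  qed (use A in \<open>auto simp: zero_ereal_def[symmetric]\<close>)
  then show ?thesis
    unfolding data_law_eq_drift_law primitive_add[OF f g(1)] .
qed

lemma prob_space_data_law:
  assumes "two_sided_brownian_motion M W" "continuous_on UNIV f"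
  shows "prob_space (data_law M W h s f)"
  unfolding data_law_eq_drift_law
  using DERIV_primitive[OF assms(2)]
  by (intro prob_space_drift_law assms(1)) (meson DERIV_isCont continuous_at_imp_continuous_on)

lemma sets_data_law: "sets (data_law M W h s f) = sets (path_space h)"
  by (simp add: data_law_def)

section \<open>The perturbed functions\<close>

text \<open>The condition on J bounds the support of a tail starting at level i by the dyadic length
  2^(J - 2) / 2^i: this is 1/4 for the base function, where i = J, and the spacing of the spikes in
  general.\<close>

locale self_similar_construction = lacunary_bump \<psi> D s N A C
  for \<psi> :: "nat \<Rightarrow> real \<Rightarrow> real" and D s :: real and N A C :: nat +
  fixes K :: "real \<Rightarrow> real \<Rightarrow> real" and V :: real and J :: nat
  assumes K_bound: "\<And>v. \<bar>K 0 v\<bar> \<le> V" and sV: "4 * s * V \<le> 1"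
    and K_supp: "\<And>x y. \<bar>x - y\<bar> > real C \<Longrightarrow> K y x = 0"
    and K_per: "\<And>(k::int) x y. K y x = K (y - of_int k) (x - of_int k)"
    and J: "2 \<le> J" "A + 1 \<le> 2 ^ (J - 2)"
begin

text \<open>A tail then has Hoelder constant 4 amp D = 1/2, so base function and spike together stay
  within constant 1.\<close>

definition amp :: real where "amp = 1 / (8 * D)"

definition tail_coeff :: "real \<Rightarrow> nat \<Rightarrow> nat \<Rightarrow> real" where
  "tail_coeff \<gamma> i j = (if i \<le> j then amp * 2 powr (- (real j * \<gamma>)) else 0)"

definition base_fn :: "real \<Rightarrow> real \<Rightarrow> real" where
  "base_fn \<gamma> = lac 0 (tail_coeff \<gamma> J) 0"

text \<open>For \<open>J <= i\<close> the interval [1/2, 1] holds 2^(i - J + 1) cells with one spike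
  each. The base function vanishes from 1/4 on; the gap up to 1/2 leaves room for its kernel
  windows.\<close>

definition site :: "nat \<Rightarrow> nat \<Rightarrow> real" where
  "site i k = 1 / 2 + real k * (2 ^ (J - 2) / 2 ^ i)"

definition spike :: "real \<Rightarrow> nat \<Rightarrow> nat \<Rightarrow> real \<Rightarrow> real" where
  "spike \<gamma> i k = lac 0 (tail_coeff \<gamma> i) (site i k)"

lemma amp: "0 < amp" "amp < 1" "4 * amp * D = 1 / 2"
  using D by (auto simp: amp_def field_simps)

lemma tail_coeff_bounds:
  shows "0 \<le> tail_coeff \<gamma> i j"
    and "\<gamma>' \<le> \<gamma> \<Longrightarrow> \<bar>tail_coeff \<gamma> i j\<bar> \<le> amp * 2 powr (- (real j * \<gamma>'))"
    and "0 \<le> \<gamma> \<Longrightarrow> \<bar>tail_coeff \<gamma> i j\<bar> \<le> amp * 2 powr (- (real i * \<gamma>))"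
  using amp by (auto simp: tail_coeff_def mult_left_mono mult_right_mono)

lemma tail_in_holder_class:
  assumes "0 < \<gamma>'" "\<gamma>' \<le> \<gamma>" "\<gamma>' \<le> real N"
  shows "lac 0 (tail_coeff \<gamma> i) q \<in> holder_class \<gamma>' (1 / 2)"
  using lac_in_holder_class[OF tail_coeff_bounds(2)[OF assms(2)] assms(1,3)] amp(3) by simp

lemma continuous_on_tail:
  assumes "0 < \<gamma>" "\<gamma> \<le> real N"
  shows "continuous_on UNIV (lac 0 (tail_coeff \<gamma> i) q)"
proof (rule continuous_on_lac)
  show "\<bar>tail_coeff \<gamma> i j\<bar> \<le> amp * 2 powr (- (real j * \<gamma>))" for j
    by (rule tail_coeff_bounds(2)) simp
qed (use assms in \<open>auto intro: Nat.gr0I\<close>)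

lemma A_less: "real A + 1 \<le> 2 ^ (J - 2)"
proof -
  have "real (A + 1) \<le> real (2 ^ (J - 2))" using J(2) by (simp only: of_nat_le_iff)
  then show ?thesis by simp
qed

lemma pow_J: "(2::real) ^ J = 4 * 2 ^ (J - 2)"
proof -
  have "(2::real) ^ (2 + (J - 2)) = 4 * 2 ^ (J - 2)" by (simp add: power_add)
  then show ?thesis by (simp only: le_add_diff_inverse[OF J(1)])
qed

lemma tail_nonzeroD:
  assumes "lac 0 (tail_coeff \<gamma> i) q x \<noteq> 0"
  shows "q < x" "x < q + 2 ^ (J - 2) / 2 ^ i"
proof -
  have *: "tail_coeff \<gamma> i j = 0" if "j < i" for j using that by (simp add: tail_coeff_def)
  show "q < x" using lac_nonzeroD(1)[of i "tail_coeff \<gamma> i", OF * assms] .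
  have "(real A + 1) / 2 ^ i \<le> 2 ^ (J - 2) / 2 ^ i" using A_less by (intro divide_right_mono) auto
  then show "x < q + 2 ^ (J - 2) / 2 ^ i"
    using lac_nonzeroD(2)[of i "tail_coeff \<gamma> i", OF * assms] by linarith
qed

text \<open>\<open>F\<close> has to agree with the tail only within the range of the kernel, so the
  lemma applies to the base function alone and to either part of a perturbed function. As A is an
  integer, a dyadic q gives a dyadic centre.\<close>

lemma tail_bias:
  assumes q: "2 ^ j * q \<in> \<int>"
    and F: "\<And>x. \<bar>2 ^ j * (x - q) - real A\<bar> \<le> real C \<Longrightarrow> F x = lac 0 (tail_coeff \<gamma> i) q x"
  shows "tail_coeff \<gamma> i j / 2 \<le> \<bar>kernel_op K (int j) F (q + A / 2 ^ j) - F (q + A / 2 ^ j)\<bar>"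
proof -
  let ?t = "q + A / 2 ^ j"
  have e: "2 ^ j * (x - ?t) = 2 ^ j * (x - q) - real A" for x by (simp add: field_simps)
  have "2 ^ j * ?t \<in> \<int>" using q by (simp add: distrib_left)
  then obtain z where z: "2 ^ j * ?t = of_int z" by (elim Ints_cases)
  show ?thesis
  proof (rule kernel_op_bias[where K = K, OF K_bound K_supp K_per s(1) sV z])
    show "\<bar>F ?t\<bar> = tail_coeff \<gamma> i j"
      using F[of ?t] lac_peak[of "tail_coeff \<gamma> i" q j] tail_coeff_bounds(1)[of \<gamma> i j] by simp
    fix x assume "\<bar>2 ^ j * (x - ?t)\<bar> \<le> real C"
    then have x: "\<bar>2 ^ j * (x - q) - real A\<bar> \<le> real C" by (simp only: e)
    show "\<bar>F x\<bar> \<le> (if \<bar>2 ^ j * (x - ?t)\<bar> \<le> s then tail_coeff \<gamma> i j else 0)"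
      using lac_window[OF x, of "tail_coeff \<gamma> i"] tail_coeff_bounds(1)[of \<gamma> i j] unfolding F[OF x] e by simp
  qed
qed

lemma base_fn_zero: "1 / 4 \<le> x \<Longrightarrow> base_fn \<gamma> x = 0"
  using tail_nonzeroD(2)[of \<gamma> J 0 x] unfolding base_fn_def pow_J by fastforce

lemma C_le_A: "real C \<le> real A" using A by simp

lemma low_point:
  assumes "J \<le> j"
  shows "real A / 2 ^ j \<le> 1 / 4" "0 + real A / 2 ^ j \<in> {0..1}"
proof -
  have "(2::real) ^ J \<le> 2 ^ j" using assms by simp
  then have "real A \<le> 2 ^ j / 4" using A_less pow_J by linarith
  then show le: "real A / 2 ^ j \<le> 1 / 4" by (simp add: field_simps)
  have "0 \<le> real A / 2 ^ j" by simp
  with le show "0 + real A / 2 ^ j \<in> {0..1}" unfolding atLeastAtMost_iff by linarith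
qed

lemma low_window:
  assumes "J \<le> j" "\<bar>2 ^ j * (x - 0) - real A\<bar> \<le> real C"
  shows "x \<le> 1 / 2"
proof -
  have "2 ^ j * x \<le> 2 * real A" using assms(2) C_le_A by simp
  then have "x \<le> 2 * (real A / 2 ^ j)" by (simp add: field_simps)
  then show ?thesis using low_point(1)[OF assms(1)] by linarith
qed

lemma base_fn_self_sim:
  assumes "0 < \<gamma>" "\<gamma> \<le> real N" "\<epsilon> \<le> amp / 2" "int J \<le> l"
  shows "base_fn \<gamma> \<in> self_sim_class \<gamma> 1 \<epsilon> K l"
  unfolding self_sim_class_def
proof (intro CollectI conjI allI impI)
  show "base_fn \<gamma> \<in> holder_class \<gamma> 1"
    unfolding base_fn_def
    by (rule holder_class_mono[OF tail_in_holder_class[OF assms(1) order_refl assms(2)]]) simp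
  fix j :: int assume "l \<le> j"
  then obtain n where n: "j = int n" "J \<le> n" using assms(4) by (intro that[of "nat j"]) auto
  note t = low_point(2)[OF n(2)]
  have "\<epsilon> * 2 powr (- (real n * \<gamma>)) \<le> amp / 2 * 2 powr (- (real n * \<gamma>))"
    using assms(3) by (intro mult_right_mono) auto
  also have "\<dots> = tail_coeff \<gamma> J n / 2" using n(2) by (simp add: tail_coeff_def)
  also have "\<dots> \<le> \<bar>kernel_op K (int n) (base_fn \<gamma>) (0 + A / 2 ^ n) - base_fn \<gamma> (0 + A / 2 ^ n)\<bar>"
    by (rule tail_bias) (auto simp: base_fn_def)
  finally have "ereal (\<epsilon> * 1 * 2 powr (- (real_of_int j * \<gamma>)))
      \<le> ereal \<bar>kernel_op K j (base_fn \<gamma>) (0 + A / 2 ^ n) - base_fn \<gamma> (0 + A / 2 ^ n)\<bar>"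
    by (simp add: n(1))
  also have "\<dots> \<le> (SUP t\<in>{0..1}. ereal \<bar>kernel_op K j (base_fn \<gamma>) t - base_fn \<gamma> t\<bar>)"
    using t by (rule SUP_upper)
  finally show "ereal (\<epsilon> * 1 * 2 powr (- (real_of_int j * \<gamma>)))
      \<le> (SUP t\<in>{0..1}. ereal \<bar>kernel_op K j (base_fn \<gamma>) t - base_fn \<gamma> t\<bar>)" .
qed

lemma site_ge: "1 / 2 \<le> site i k"
  by (simp add: site_def)

lemma site_Suc: "site i (Suc k) = site i k + 2 ^ (J - 2) / 2 ^ i"
  by (simp add: site_def algebra_simps add_divide_distrib)

lemma site_le:
  assumes "J \<le> i" "k < 2 ^ (i - J + 1)"
  shows "site i (Suc k) \<le> 1"
proof -
  have "real (Suc k) \<le> real (2 ^ (i - J + 1))" using assms(2) by (simp only: of_nat_le_iff Suc_le_eq)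
  then have "real (Suc k) \<le> 2 ^ (i - J + 1)" by simp
  then have "real (Suc k) * (2 ^ (J - 2) / 2 ^ i) \<le> 2 ^ (i - J + 1) * (2 ^ (J - 2) / 2 ^ i)"
    by (intro mult_right_mono) auto
  also have "\<dots> = 1 / 2"
  proof -
    have "(2::real) ^ i = 2 ^ ((i - J + 1) + (J - 2) + 1)" using assms(1) J(1) by (intro arg_cong[where f = "power 2"]) simp
    also have "\<dots> = 2 ^ (i - J + 1) * 2 ^ (J - 2) * 2" by (simp only: power_add power_one_right)
    finally show ?thesis by simp
  qed
  finally show ?thesis unfolding site_def by linarith
qed

lemma site_dyadic:
  assumes "J \<le> i" "i \<le> j"
  shows "2 ^ j * site i k \<in> \<int>"
proof -
  have "(2::real) ^ j = 2 ^ (j - i) * 2 ^ i" using assms(2) by (simp add: power_add[symmetric])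
  then have "2 ^ j * (real k * (2 ^ (J - 2) / 2 ^ i)) = 2 ^ (j - i) * (real k * 2 ^ (J - 2))" by simp
  moreover have "(2::real) ^ j = 2 * 2 ^ (j - 1)" using assms J(1) by (simp add: power_eq_if)
  ultimately have "2 ^ j * site i k = 2 ^ (j - 1) + 2 ^ (j - i) * (real k * 2 ^ (J - 2))"
    by (simp add: site_def distrib_left)
  also have "\<dots> \<in> \<int>" by (intro Ints_add Ints_mult Ints_power) auto
  finally show ?thesis .
qed

lemma spike_zero: "x \<le> site i k \<or> site i (Suc k) \<le> x \<Longrightarrow> spike \<gamma> i k x = 0"
  using tail_nonzeroD[of \<gamma> i "site i k" x] unfolding spike_def site_Suc by fastforce

lemma spike_bound: "0 \<le> \<gamma> \<Longrightarrow> \<bar>spike \<gamma> i k x\<bar> \<le> amp * 2 powr (- (real i * \<gamma>))"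
  unfolding spike_def by (rule lac_abs_le) (rule tail_coeff_bounds(3))

lemma perturbed_peak:
  assumes "J \<le> i" "k < 2 ^ (i - J + 1)"
  defines "x \<equiv> site i k + real A / 2 ^ i"
  shows "x \<in> {0..1}" "spike \<gamma> i k x = amp * 2 powr (- (real i * \<gamma>))"
proof -
  have "real A \<le> 2 ^ (J - 2)" using A_less by linarith
  then have "real A / 2 ^ i \<le> 2 ^ (J - 2) / 2 ^ i" by (rule divide_right_mono) simp
  then have "x \<le> site i (Suc k)" by (simp add: x_def site_Suc)
  moreover have "site i k \<le> x" by (simp add: x_def)
  ultimately show "x \<in> {0..1}" using site_ge[of i k] site_le[OF assms(1,2)] by auto
  show "spike \<gamma> i k x = amp * 2 powr (- (real i * \<gamma>))"
    unfolding spike_def x_def lac_peak by (simp add: tail_coeff_def)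
qed

text \<open>Below level \<open>i\<close> the bias comes from the base function, from level \<open>i\<close> on from the spike. The
  condition on \<open>\<epsilon>\<close> says that the bias \<open>amp / 2 \<cdot> 2\<^bsup>-j\<gamma>\<^esup>\<close> of the base function suffices for the
  smoothness \<open>\<gamma>' \<le> \<gamma>\<close> up to level \<open>i\<close>.\<close>

lemma perturbed_self_sim:
  assumes "0 < \<gamma>'" "\<gamma>' \<le> \<gamma>" "\<gamma> \<le> real N" and "0 < \<epsilon>" "\<epsilon> * 2 powr (real i * (\<gamma> - \<gamma>')) \<le> amp / 2"
    and "int J \<le> l" "J \<le> i" "k < 2 ^ (i - J + 1)"
  shows "(\<lambda>x. base_fn \<gamma> x + spike \<gamma>' i k x) \<in> self_sim_class \<gamma>' 1 \<epsilon> K l"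
  unfolding self_sim_class_def
proof (intro CollectI conjI allI impI)
  let ?F = "\<lambda>x. base_fn \<gamma> x + spike \<gamma>' i k x"
  show "?F \<in> holder_class \<gamma>' 1"
    unfolding base_fn_def spike_def
    using holder_class_add[OF tail_in_holder_class[of \<gamma>' \<gamma>] tail_in_holder_class[of \<gamma>' \<gamma>']] assms by simp
  fix j :: int assume "l \<le> j"
  then obtain n where n: "j = int n" "J \<le> n" using assms(6) by (intro that[of "nat j"]) auto
  \<comment> \<open>The condition at level i implies it at every lower level; at level 0 it reads
    \<epsilon> <= amp / 2, which is used for the levels from i on.\<close>
  have eps: "\<epsilon> * 2 powr (real n' * (\<gamma> - \<gamma>')) \<le> amp / 2" if "n' \<le> i" for n'
    using that assms(2,4) by (intro order_trans[OF mult_left_mono assms(5)]) (auto intro!: mult_right_mono)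
  have "\<exists>t\<in>{0..1}. \<epsilon> * 2 powr (- (real n * \<gamma>')) \<le> \<bar>kernel_op K (int n) ?F t - ?F t\<bar>"
  proof (cases "n < i")
    case True
    have "\<epsilon> * 2 powr (- (real n * \<gamma>')) = \<epsilon> * 2 powr (real n * (\<gamma> - \<gamma>')) * 2 powr (- (real n * \<gamma>))"
      by (simp add: powr_add[symmetric] algebra_simps)
    also have "\<dots> \<le> amp / 2 * 2 powr (- (real n * \<gamma>))"
      using eps[of n] True by (intro mult_right_mono) auto
    also have "\<dots> = tail_coeff \<gamma> J n / 2" using n(2) by (simp add: tail_coeff_def)
    also have "\<dots> \<le> \<bar>kernel_op K (int n) ?F (0 + A / 2 ^ n) - ?F (0 + A / 2 ^ n)\<bar>"
    proof (rule tail_bias)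
      fix x :: real assume "\<bar>2 ^ n * (x - 0) - real A\<bar> \<le> real C"
      then have "x \<le> site i k" using low_window[OF n(2)] site_ge[of i k] by force
      then show "?F x = lac 0 (tail_coeff \<gamma> J) 0 x" by (simp add: spike_zero base_fn_def)
    qed simp
    finally show ?thesis using low_point(2)[OF n(2)] by blast
  next
    case False
    then have in': "i \<le> n" by simp
    have "\<epsilon> * 2 powr (- (real n * \<gamma>')) \<le> amp / 2 * 2 powr (- (real n * \<gamma>'))"
      using eps[of 0] by (intro mult_right_mono) auto
    also have "\<dots> = tail_coeff \<gamma>' i n / 2" using in' by (simp add: tail_coeff_def)
    also have "\<dots> \<le> \<bar>kernel_op K (int n) ?F (site i k + A / 2 ^ n) - ?F (site i k + A / 2 ^ n)\<bar>"
    proof (rule tail_bias[OF site_dyadic[OF assms(7) in']])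
      fix x :: real assume "\<bar>2 ^ n * (x - site i k) - real A\<bar> \<le> real C"
      then have "0 \<le> 2 ^ n * (x - site i k)" using C_le_A by linarith
      then have "site i k \<le> x"
        using mult_pos_neg[of "2 ^ n" "x - site i k"] by (intro leI notI) simp
      then have "1 / 4 \<le> x" using site_ge[of i k] by linarith
      then show "?F x = lac 0 (tail_coeff \<gamma>' i) (site i k) x" by (simp add: spike_def base_fn_zero)
    qed
    finally have le: "\<epsilon> * 2 powr (- (real n * \<gamma>'))
      \<le> \<bar>kernel_op K (int n) ?F (site i k + A / 2 ^ n) - ?F (site i k + A / 2 ^ n)\<bar>" .
    have "real A / 2 ^ n \<le> real A / 2 ^ i" using in' by (intro divide_left_mono) auto
    then have "site i k + A / 2 ^ n \<in> {0..1}"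
      using perturbed_peak(1)[OF assms(7,8)] site_ge[of i k] by auto
    with le show ?thesis by blast
  qed
  then obtain t where "t \<in> {0..1}" "ereal (\<epsilon> * 1 * 2 powr (- (real_of_int j * \<gamma>'))) \<le> ereal \<bar>kernel_op K j ?F t - ?F t\<bar>"
    by (auto simp: n(1))
  then show "ereal (\<epsilon> * 1 * 2 powr (- (real_of_int j * \<gamma>'))) \<le> (SUP t\<in>{0..1}. ereal \<bar>kernel_op K j ?F t - ?F t\<bar>)"
    by (rule SUP_upper2)
qed

text \<open>The base function, of order \<gamma>, belongs to both classes and carries the risk; the
  perturbed functions, of order \<gamma>', only have to be covered. \<open>small\<close> is the
  mixture bound for 2^(i - J + 1) spikes of height amp 2^(-i \<gamma>') and width 2^(J - 2) /
  2^i.\<close>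

lemma minimax_length_ge:
  fixes \<gamma> \<gamma>' :: real and i :: nat
  assumes W: "two_sided_brownian_motion M W" and "0 < t"
    and \<gamma>: "0 < \<gamma>'" "\<gamma>' \<le> \<gamma>" "\<gamma> \<le> real N" "\<gamma>' \<in> R" "\<gamma> \<in> R"
    and \<epsilon>: "0 < \<epsilon>" "\<epsilon> \<le> \<epsilon>'" "\<epsilon>' \<le> amp / 2" "\<epsilon> * 2 powr (real i * (\<gamma> - \<gamma>')) \<le> amp / 2"
    and i: "int J \<le> l" "J \<le> i"
    and small: "sqrt (exp ((amp * 2 powr (- (real i * \<gamma>')))\<^sup>2 * (2 ^ (J - 2) / 2 ^ i) / t\<^sup>2) / 2 ^ (i - J + 1))
      < \<beta> - 2 * \<alpha>"
  shows "ereal (amp * 2 powr (- (real i * \<gamma>'))) \<le> minimax_length (data_law M W h t) h \<alpha> \<beta>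
    (self_sim_class \<gamma> 1 \<epsilon>' K l) (\<Union>\<rho>\<in>R. self_sim_class \<rho> 1 \<epsilon> K l)"
  unfolding minimax_length_def
proof (rule INF_greatest)
  let ?F = "\<Union>\<rho>\<in>R. self_sim_class \<rho> 1 \<epsilon> K l"
  fix Cb assume Cb: "Cb \<in> covering_bands (data_law M W h t) h \<alpha> ?F"
  let ?g = "\<lambda>k x. base_fn \<gamma> x + spike \<gamma>' i k x"
  have cont: "continuous_on UNIV (base_fn \<gamma>)" "continuous_on UNIV (spike \<gamma>' i k)" for k
    unfolding base_fn_def spike_def using \<gamma>(1-3) by (intro continuous_on_tail; linarith)+
  have f: "base_fn \<gamma> \<in> self_sim_class \<gamma> 1 \<epsilon> K l" "base_fn \<gamma> \<in> self_sim_class \<gamma> 1 \<epsilon>' K l"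
    using \<gamma>(1-3) \<epsilon>(2,3) i(1) by (intro base_fn_self_sim; linarith)+
  show "ereal (amp * 2 powr (- (real i * \<gamma>'))) \<le> band_risk (data_law M W h t) \<beta> Cb (self_sim_class \<gamma> 1 \<epsilon>' K l)"
  proof (rule band_risk_ge[OF Cb, where f = "base_fn \<gamma>" and g = ?g and m = "2 ^ (i - J + 1)"
        and x = "\<lambda>k. site i k + real A / 2 ^ i", OF _ _ _ _ _ _ _ _ _ small])
    fix k :: nat assume k: "k < 2 ^ (i - J + 1)"
    show "?g k \<in> ?F" using perturbed_self_sim[OF \<gamma>(1,2,3) \<epsilon>(1,4) i k] \<gamma>(4) by blast
    show "site i k + real A / 2 ^ i \<in> {0..1}" by (rule perturbed_peak(1)[OF i(2) k])
    show "?g k (site i k + real A / 2 ^ i) = base_fn \<gamma> (site i k + real A / 2 ^ i) + amp * 2 powr (- (real i * \<gamma>'))"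
      by (simp only: perturbed_peak(2)[OF i(2) k])
  next
    fix S assume S: "S \<in> sets (path_space h)"
    have "\<bar>measure (data_law M W h t (base_fn \<gamma>)) S - (\<Sum>k<2 ^ (i - J + 1). measure (data_law M W h t (?g k)) S) / real (2 ^ (i - J + 1))\<bar>
      \<le> sqrt (exp ((amp * 2 powr (- (real i * \<gamma>')))\<^sup>2 * (2 ^ (J - 2) / 2 ^ i) / t\<^sup>2) / real (2 ^ (i - J + 1)))"
    proof (rule data_law_mixture_distance[OF W \<open>0 < t\<close> _ cont _ _ _ _ S])
      show "\<bar>spike \<gamma>' i k x\<bar> \<le> amp * 2 powr (- (real i * \<gamma>'))" for k x
        using \<gamma>(1) by (intro spike_bound) simp
      show "site i k \<le> site i (Suc k)" "site i (Suc k) - site i k \<le> 2 ^ (J - 2) / 2 ^ i" for k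
        by (simp_all add: site_Suc)
      show "x \<le> site i k \<or> site i (Suc k) \<le> x \<Longrightarrow> spike \<gamma>' i k x = 0" for k x
        by (rule spike_zero)
    qed simp
    then show "\<bar>measure (data_law M W h t (base_fn \<gamma>)) S - (\<Sum>k<2 ^ (i - J + 1). measure (data_law M W h t (?g k)) S) / real (2 ^ (i - J + 1))\<bar>
      \<le> sqrt (exp ((amp * 2 powr (- (real i * \<gamma>')))\<^sup>2 * (2 ^ (J - 2) / 2 ^ i) / t\<^sup>2) / 2 ^ (i - J + 1))"
      by simp
  next
    fix f' assume "f' \<in> insert (base_fn \<gamma>) (?g ` {..<2 ^ (i - J + 1)})"
    then have "continuous_on UNIV f'"
      using cont(1) continuous_on_add[OF cont] by auto
    then show "prob_space (data_law M W h t f')" by (rule prob_space_data_law[OF W])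
  next
    show "base_fn \<gamma> \<in> ?F" using f(1) \<gamma>(5) by blast
    show "base_fn \<gamma> \<in> self_sim_class \<gamma> 1 \<epsilon>' K l" by (rule f(2))
    show "sets (data_law M W h t f') = sets (path_space h)" for f' by (rule sets_data_law)
    show "(0::nat) < 2 ^ (i - J + 1)" by simp
  qed
qed

end

section \<open>The rate\<close>

context self_similar_construction
begin

text \<open>Chosen so that 2^(J - 2) times it equals \<kappa> / 2 for \<kappa> = 1 / (2 (2 \<Gamma>
  + 1)); this keeps the logarithm of the second moment below \<kappa> ln (1/t).\<close>

definition noise_fraction :: "real \<Rightarrow> real" where
  "noise_fraction \<Gamma> = 1 / (2 ^ J * (2 * \<Gamma> + 1))"

text \<open>amp times amp / 2 comes from the height times the gain amp / (2 \<epsilon>),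
  2^(-\<Gamma>) from rounding the level up, and the last factor is a lower bound for its own power
  \<gamma> / (2 \<gamma> + 1). Taking worst cases over \<gamma> <= \<Gamma> removes the dependence
  on \<gamma>.\<close>

definition rate_constant :: "real \<Rightarrow> real" where
  "rate_constant \<Gamma> = amp\<^sup>2 / 2 * 2 powr (- \<Gamma>) * noise_fraction \<Gamma>"

text \<open>The perturbation level \<open>i\<close> is the least one at which \<open>2\<^bsup>-i(2\<gamma>+1)\<^esup>\<close> falls below a small multiple of
  \<open>\<epsilon>\<^sup>2 t\<^sup>2 ln (1/t)\<close>. Lowering the smoothness to \<open>\<gamma>'\<close> with \<open>2\<^bsup>i(\<gamma>-\<gamma>')\<^esup> = amp / (2\<epsilon>)\<close> gains a factor of order
  \<open>1/\<epsilon>\<close> in the height of the spikes, and \<open>\<gamma>' \<rightarrow> \<gamma>\<close> as \<open>t \<rightarrow> 0\<close>.\<close>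

lemma minimax_length_rate:
  fixes \<Gamma> \<gamma> \<gamma>\<^sub>l \<epsilon> t :: real
  defines "\<kappa> \<equiv> 1 / (2 * (2 * \<Gamma> + 1))"
  assumes W: "two_sided_brownian_motion M W" and t: "0 < t" "t < 1"
    and \<gamma>: "0 < \<gamma>\<^sub>l" "\<gamma>\<^sub>l < \<gamma>" "\<gamma> \<le> \<Gamma>" "\<gamma> \<le> \<gamma>\<^sub>u" "\<Gamma> \<le> real N"
    and \<epsilon>: "0 < \<epsilon>" "\<epsilon> \<le> \<epsilon>'" "\<epsilon>' < amp / 2" and l: "int J \<le> l"
    and t1: "sqrt (2 ^ J * t powr \<kappa>) < \<beta> - 2 * \<alpha>"
    and t2: "real J \<le> 2 * \<kappa> * log 2 (1 / t)"
    and t3: "log 2 (amp / (2 * \<epsilon>)) / (\<gamma> - \<gamma>\<^sub>l) \<le> 2 * \<kappa> * log 2 (1 / t)"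
  shows "ereal (rate_constant \<Gamma> * \<epsilon> powr (- 1 / (2 * \<gamma> + 1)) * (t\<^sup>2 * ln (1 / t)) powr (\<gamma> / (2 * \<gamma> + 1)))
    \<le> minimax_length (data_law M W h t) h \<alpha> \<beta> (self_sim_class \<gamma> 1 \<epsilon>' K l)
        (\<Union>\<rho>\<in>{\<gamma>\<^sub>l..\<gamma>\<^sub>u}. self_sim_class \<rho> 1 \<epsilon> K l)"
proof -
  define e where "e = 2 * \<gamma> + 1"
  define \<tau> where "\<tau> = noise_fraction \<Gamma>"
  define X where "X = t\<^sup>2 * ln (1 / t)"
  define T where "T = \<tau> * \<epsilon>\<^sup>2 * X"
  define y where "y = log 2 (1 / T) / e"
  define i where "i = nat \<lceil>y\<rceil>"
  define \<rho> where "\<rho> = amp / (2 * \<epsilon>)"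
  define \<gamma>' where "\<gamma>' = \<gamma> - log 2 \<rho> / real i"
  have e: "e > 1" "2 * \<kappa> \<le> 1 / e" using \<gamma> by (auto simp: e_def \<kappa>_def field_simps)
  have \<kappa>: "\<kappa> > 0" using \<gamma> by (simp add: \<kappa>_def)
  have "1 \<le> (2::real) ^ J" by simp
  then have "1 * 1 \<le> 2 ^ J * (2 * \<Gamma> + 1)" using \<gamma> by (intro mult_mono) auto
  then have \<tau>: "0 < \<tau>" "\<tau> \<le> 1" by (auto simp: \<tau>_def noise_fraction_def)
  have ln_t: "0 < ln (1 / t)" using t by simp
  have X: "0 < X" using t ln_t by (simp add: X_def)
  have "ln (1 / t) \<le> 1 / t" using ln_le_minus_one[of "1 / t"] t by simp
  then have "t\<^sup>2 * ln (1 / t) \<le> t\<^sup>2 * (1 / t)" by (intro mult_left_mono) auto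
  then have X_le: "X \<le> t" using t by (simp add: X_def power2_eq_square)
  have "\<epsilon> \<le> 1" using \<epsilon> amp by linarith
  then have "\<epsilon>\<^sup>2 \<le> 1" using \<epsilon> by (simp add: power_le_one)
  then have "\<tau> * \<epsilon>\<^sup>2 \<le> 1 * 1" using \<tau> by (intro mult_mono) auto
  then have "T \<le> 1 * X" unfolding T_def using X by (intro mult_right_mono) auto
  then have "T \<le> t" using X_le by simp
  moreover have "0 < T" using X \<tau> \<epsilon> by (simp add: T_def)
  ultimately have T: "0 < T" "T \<le> t" by simp_all
  \<comment> \<open>The crude bound T <= t is enough here: it already gives 2^i >= t^(-2 \<kappa>),
    hence sufficiently many spikes.\<close>
  have "log 2 (1 / t) \<le> log 2 (1 / T)" using T t by (simp add: frac_le)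
  moreover have log_t: "0 < log 2 (1 / t)" using t by simp
  ultimately have "2 * \<kappa> * log 2 (1 / t) \<le> 1 / e * log 2 (1 / T)"
    using e by (intro mult_mono) auto
  then have y: "2 * \<kappa> * log 2 (1 / t) \<le> y" by (simp add: y_def)
  then have "0 < y" using \<kappa> log_t by (intro less_le_trans[OF _ y] mult_pos_pos) auto
  then have i: "y \<le> real i" "real i \<le> y + 1" "0 < real i" unfolding i_def by linarith+
  have Ji: "J \<le> i" using t2 y i by linarith
  have T_powr: "2 powr (- (y * e)) = T"
    using T e by (simp add: y_def powr_minus)
  have \<rho>: "1 < \<rho>" "\<epsilon> * \<rho> = amp / 2" using \<epsilon> by (auto simp: \<rho>_def field_simps)
  have "real i * (\<gamma> - \<gamma>') = log 2 \<rho>" using i by (simp add: \<gamma>'_def)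
  then have gain: "2 powr (real i * (\<gamma> - \<gamma>')) = \<rho>" using \<rho> by simp
  have "log 2 \<rho> / (\<gamma> - \<gamma>\<^sub>l) \<le> real i" using t3 y i by (simp add: \<rho>_def)
  then have "log 2 \<rho> / real i \<le> \<gamma> - \<gamma>\<^sub>l" using i \<gamma> by (simp add: field_simps)
  moreover have "0 \<le> log 2 \<rho> / real i" using \<rho> i by simp
  ultimately have \<gamma>': "\<gamma>\<^sub>l \<le> \<gamma>'" "\<gamma>' \<le> \<gamma>" by (simp_all add: \<gamma>'_def)
  define L where "L = amp * 2 powr (- (real i * \<gamma>'))"
  have "2 powr (- (real i * \<gamma>')) = 2 powr (real i * (\<gamma> - \<gamma>')) * 2 powr (- (real i * \<gamma>))"
    by (simp add: powr_add[symmetric] algebra_simps)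
  then have L: "L = amp * \<rho> * 2 powr (- (real i * \<gamma>))" by (simp add: L_def gain)

  \<comment> \<open>The exponential is at most t^(-\<kappa>) and the number of spikes at least t^(-2
    \<kappa>) / 2^J, so the quotient is at most 2^J t^\<kappa>, the quantity in
    \<open>t1\<close>.\<close>
  have small: "sqrt (exp (L\<^sup>2 * (2 ^ (J - 2) / 2 ^ i) / t\<^sup>2) / 2 ^ (i - J + 1)) < \<beta> - 2 * \<alpha>"
  proof -
    have "(2 powr (- (real i * \<gamma>)))\<^sup>2 * (1 / 2 ^ i) =
        2 powr (- (real i * \<gamma>)) * 2 powr (- (real i * \<gamma>)) * 2 powr (- real i)"
      by (simp add: power2_eq_square two_powr_nat powr_minus_divide)
    also have "\<dots> = 2 powr (- (real i * \<gamma>) + - (real i * \<gamma>) + - real i)" by (simp only: powr_add)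
    also have "\<dots> = 2 powr (- (real i * e))" by (simp add: e_def algebra_simps)
    also have "\<dots> \<le> 2 powr (- (y * e))" using i e by (intro powr_mono) auto
    finally have "(2 powr (- (real i * \<gamma>)))\<^sup>2 * (1 / 2 ^ i) \<le> T" by (simp only: T_powr)
    then have "amp\<^sup>2 * \<rho>\<^sup>2 * 2 ^ (J - 2) / t\<^sup>2 * ((2 powr (- (real i * \<gamma>)))\<^sup>2 * (1 / 2 ^ i))
        \<le> amp\<^sup>2 * \<rho>\<^sup>2 * 2 ^ (J - 2) / t\<^sup>2 * T"
      by (intro mult_left_mono) auto
    \<comment> \<open>The squared gain \<rho>^2 meets the factor \<epsilon>^2 of T; since \<epsilon>
      \<rho> = amp / 2, the exponent is free of \<epsilon>.\<close>
    also have "\<dots> = amp\<^sup>2 * (\<epsilon> * \<rho>)\<^sup>2 * (2 ^ (J - 2) * \<tau>) * ln (1 / t)"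
      using t by (simp add: T_def X_def power_mult_distrib)
    also have "2 ^ (J - 2) * \<tau> = \<kappa> / 2"
    proof -
      have "a * (1 / (4 * a * b)) = 1 / (2 * b) / 2" if "a \<noteq> 0" for a b :: real using that by simp
      then show ?thesis unfolding \<tau>_def noise_fraction_def pow_J \<kappa>_def by simp
    qed
    also have "amp\<^sup>2 * (\<epsilon> * \<rho>)\<^sup>2 * (\<kappa> / 2) * ln (1 / t) \<le> 1 * 1 * \<kappa> * ln (1 / t)"
      using amp ln_t \<kappa> unfolding \<rho>(2) by (intro mult_mono mult_nonneg_nonneg) (auto simp: power_le_one)
    finally have "L\<^sup>2 * (2 ^ (J - 2) / 2 ^ i) / t\<^sup>2 \<le> \<kappa> * ln (1 / t)"
      by (simp add: L power_mult_distrib field_simps)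
    then have "exp (L\<^sup>2 * (2 ^ (J - 2) / 2 ^ i) / t\<^sup>2) \<le> exp (\<kappa> * ln (1 / t))" by simp
    also have "\<dots> = t powr (- \<kappa>)" using t by (simp add: powr_def ln_div)
    finally have num: "exp (L\<^sup>2 * (2 ^ (J - 2) / 2 ^ i) / t\<^sup>2) \<le> t powr (- \<kappa>)" .
    have "t powr (- (2 * \<kappa>)) = 2 powr (2 * \<kappa> * log 2 (1 / t))"
      using t by (simp add: powr_def log_def ln_div)
    also have "\<dots> \<le> 2 powr real i" using y i by (intro powr_mono) auto
    also have "\<dots> = 2 ^ i" by (simp only: two_powr_nat)
    also have "(2::real) ^ i = 2 ^ J * 2 ^ (i - J)" using Ji by (simp add: power_add[symmetric])
    also have "\<dots> \<le> 2 ^ J * 2 ^ (i - J + 1)" by simp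
    finally have "exp (L\<^sup>2 * (2 ^ (J - 2) / 2 ^ i) / t\<^sup>2) / 2 ^ (i - J + 1) \<le> t powr (- \<kappa>) / (t powr (- (2 * \<kappa>)) / 2 ^ J)"
      using t num by (intro frac_le) (auto simp: field_simps)
    also have "\<dots> = 2 ^ J * (t powr (- \<kappa>) / t powr (- (2 * \<kappa>)))" by simp
    also have "t powr (- \<kappa>) / t powr (- (2 * \<kappa>)) = t powr \<kappa>" by (simp add: powr_diff[symmetric])
    finally show ?thesis using t1 real_sqrt_le_mono by (meson le_less_trans)
  qed

  have rate: "rate_constant \<Gamma> * \<epsilon> powr (- 1 / e) * X powr (\<gamma> / e) \<le> L"
  proof -
    have "\<tau> = \<tau> powr 1" using \<tau> by simp
    also have "\<dots> \<le> \<tau> powr (\<gamma> / e)" using \<tau> \<gamma> by (intro powr_mono') (auto simp: e_def field_simps)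
    finally have \<tau>_le: "\<tau> \<le> \<tau> powr (\<gamma> / e)" .
    \<comment> \<open>The gain contributes 1 / \<epsilon> and T contributes \<epsilon>^(2 \<gamma> /
      e); as 2 \<gamma> - e = -1, the product is \<epsilon>^(-1/e).\<close>
    have "\<epsilon> powr (- 1 / e) = \<epsilon> powr (2 * (\<gamma> / e) - 1)"
      using e by (intro arg_cong[where f = "\<lambda>u. \<epsilon> powr u"]) (simp add: e_def field_simps)
    also have "\<dots> = (\<epsilon> powr 2) powr (\<gamma> / e) / \<epsilon>" using \<epsilon> unfolding powr_powr by (simp add: powr_diff)
    also have "\<epsilon> powr 2 = \<epsilon>\<^sup>2" using \<epsilon> by (simp add: powr_numeral)
    finally have \<epsilon>_powr: "\<epsilon> powr (- 1 / e) = (\<epsilon>\<^sup>2) powr (\<gamma> / e) / \<epsilon>" .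
    have "2 powr (- \<Gamma>) * \<tau> * (\<epsilon>\<^sup>2) powr (\<gamma> / e) * X powr (\<gamma> / e)
        \<le> 2 powr (- \<gamma>) * \<tau> powr (\<gamma> / e) * (\<epsilon>\<^sup>2) powr (\<gamma> / e) * X powr (\<gamma> / e)"
      using \<gamma> \<tau> \<tau>_le by (intro mult_mono mult_right_mono powr_mono) auto
    also have "\<dots> = 2 powr (- \<gamma>) * T powr (\<gamma> / e)"
      using \<tau> X by (simp add: T_def powr_mult mult.assoc)
    also have "T powr (\<gamma> / e) = 2 powr (- (y * \<gamma>))"
      using e by (simp add: T_powr[symmetric] powr_powr)
    also have "2 powr (- \<gamma>) * 2 powr (- (y * \<gamma>)) = 2 powr (- ((y + 1) * \<gamma>))"
      by (simp add: powr_add[symmetric] algebra_simps)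
    also have "\<dots> \<le> 2 powr (- (real i * \<gamma>))" using i \<gamma> by (intro powr_mono) auto
    finally have "amp * \<rho> * (2 powr (- \<Gamma>) * \<tau> * (\<epsilon>\<^sup>2) powr (\<gamma> / e) * X powr (\<gamma> / e)) \<le> L"
      unfolding L using amp \<rho> by (intro mult_left_mono) auto
    moreover have "rate_constant \<Gamma> * \<epsilon> powr (- 1 / e) * X powr (\<gamma> / e) =
        amp * \<rho> * (2 powr (- \<Gamma>) * \<tau> * (\<epsilon>\<^sup>2) powr (\<gamma> / e) * X powr (\<gamma> / e))"
      unfolding rate_constant_def \<epsilon>_powr \<rho>_def \<tau>_def by (simp add: power2_eq_square mult_ac)
    ultimately show ?thesis by (simp only:)
  qed

  have "ereal L \<le> minimax_length (data_law M W h t) h \<alpha> \<beta> (self_sim_class \<gamma> 1 \<epsilon>' K l)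
        (\<Union>\<rho>\<in>{\<gamma>\<^sub>l..\<gamma>\<^sub>u}. self_sim_class \<rho> 1 \<epsilon> K l)"
    unfolding L_def
  proof (rule minimax_length_ge[OF W t(1) _ \<gamma>'(2) _ _ _ \<epsilon>(1,2) _ _ l Ji])
    show "\<epsilon> * 2 powr (real i * (\<gamma> - \<gamma>')) \<le> amp / 2" by (simp add: gain \<rho>(2))
  qed (use \<gamma> \<gamma>' \<epsilon> small in \<open>auto simp: L_def\<close>)
  with rate show ?thesis
    unfolding e_def X_def by (meson ereal_less_eq(3) order_trans)
qed

lemma rate_constant_pos: "0 < \<Gamma> \<Longrightarrow> 0 < rate_constant \<Gamma>"
  using amp by (simp add: rate_constant_def noise_fraction_def)

lemma eventually_minimax_length_rate:
  assumes W: "two_sided_brownian_motion M W" and "0 < \<sigma>"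
    and \<gamma>: "0 < \<gamma>\<^sub>l" "\<gamma>\<^sub>l < \<gamma>" "\<gamma> \<le> \<Gamma>" "\<gamma> \<le> \<gamma>\<^sub>u" "\<Gamma> \<le> real N"
    and \<epsilon>: "0 < \<epsilon>" "\<epsilon> \<le> \<epsilon>'" "\<epsilon>' < amp / 2" and l: "int J \<le> l" and \<alpha>: "2 * \<alpha> < \<beta>"
  shows "\<forall>\<^sub>F n in sequentially.
    ereal (rate_constant \<Gamma> * \<epsilon> powr (- 1 / (2 * \<gamma> + 1)) *
      ((noise_level \<sigma> n)\<^sup>2 * ln (1 / noise_level \<sigma> n)) powr (\<gamma> / (2 * \<gamma> + 1)))
    \<le> minimax_length (data_law M W h (noise_level \<sigma> n)) h \<alpha> \<beta> (self_sim_class \<gamma> 1 \<epsilon>' K l)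
        (\<Union>\<rho>\<in>{\<gamma>\<^sub>l..\<gamma>\<^sub>u}. self_sim_class \<rho> 1 \<epsilon> K l)"
proof -
  define \<kappa> where "\<kappa> = 1 / (2 * (2 * \<Gamma> + 1))"
  have \<kappa>: "\<kappa> > 0" using \<gamma> by (simp add: \<kappa>_def)
  \<comment> \<open>One threshold for \<open>t2\<close> and \<open>t3\<close>: the level must exceed
    J, and it must be high enough for \<gamma>' to stay above
    \<open>\<gamma>\<^sub>l\<close>.\<close>
  define B where "B = max (real J) (log 2 (amp / (2 * \<epsilon>)) / (\<gamma> - \<gamma>\<^sub>l))"
  have "LIM n sequentially. sqrt (real n) * (1 / \<sigma>) :> at_top"
    using \<open>0 < \<sigma>\<close> by (intro filterlim_tendsto_pos_mult_at_top[OF tendsto_const, where c = "1 / \<sigma>", unfolded mult.commute[of "1 / \<sigma>"]]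
      filterlim_compose[OF sqrt_at_top filterlim_real_sequentially]) auto
  then have lim: "LIM n sequentially. 1 / noise_level \<sigma> n :> at_top"
    by (simp add: noise_level_def)
  have "(\<lambda>n. sqrt (2 ^ J * (1 / noise_level \<sigma> n) powr (- \<kappa>))) \<longlonglongrightarrow> sqrt (2 ^ J * 0)"
    using \<kappa> by (intro tendsto_intros tendsto_neg_powr lim) auto
  then have "\<forall>\<^sub>F n in sequentially. sqrt (2 ^ J * (1 / noise_level \<sigma> n) powr (- \<kappa>)) < \<beta> - 2 * \<alpha>"
    using \<alpha> by (intro order_tendstoD(2)) auto
  moreover have "\<forall>\<^sub>F n in sequentially. max 1 (2 powr (B / (2 * \<kappa>))) < 1 / noise_level \<sigma> n"
    using lim unfolding filterlim_at_top_dense by blast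
  ultimately show ?thesis
  proof eventually_elim
    case (elim n)
    let ?t = "noise_level \<sigma> n"
    have "0 < 1 / ?t" using elim(2) by linarith
    then have t: "0 < ?t" "?t < 1" using elim(2) by (auto simp: field_simps)
    have "B / (2 * \<kappa>) \<le> log 2 (1 / ?t)"
      using elim(2) t by (intro le_log_iff[THEN iffD2]) auto
    then have "B \<le> 2 * \<kappa> * log 2 (1 / ?t)" using \<kappa> by (simp add: field_simps)
    moreover have "sqrt (2 ^ J * ?t powr \<kappa>) < \<beta> - 2 * \<alpha>"
      using elim(1) t by (simp add: powr_minus powr_divide)
    ultimately show ?case
      using t by (intro minimax_length_rate[OF W t \<gamma> \<epsilon> l]) (auto simp: \<kappa>_def B_def)
  qed
qed

end

theorem theorem2p2:
  fixes K :: "real \<Rightarrow> real \<Rightarrow> real" and \<gamma>\<^sub>u :: real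
  assumes "bv_kernel K"
    and "\<exists>C\<^sub>K. \<forall>x y. \<bar>x - y\<bar> > C\<^sub>K \<longrightarrow> K y x = 0"
    and "\<forall>(k::int) x y. K y x = K (y - of_int k) (x - of_int k)"
  shows "\<exists>C > 0. \<exists>j :: int. \<exists>\<eta>\<^sub>K > 0.
    \<forall>(\<gamma>\<^sub>l::real) (\<gamma>::real) (\<alpha>::real) (\<beta>::real) (l::int) (\<epsilon>::real) (\<epsilon>'::real) (\<sigma>::real) (\<eta>::real)
      (M :: 'a measure) (W :: real \<Rightarrow> 'a \<Rightarrow> real).
      0 < \<gamma>\<^sub>l \<and> \<gamma>\<^sub>l < \<gamma> \<and> \<gamma> \<le> \<gamma>\<^sub>u \<and> 0 < 2 * \<alpha> \<and> 2 * \<alpha> < \<beta> \<and> \<beta> < 1 \<and>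
      l \<ge> j \<and> 0 < \<epsilon> \<and> \<epsilon> \<le> \<epsilon>' \<and> \<epsilon>' < \<eta>\<^sub>K \<and>
      \<sigma> > 0 \<and> \<eta> > 0 \<and> two_sided_brownian_motion M W
      \<longrightarrow> (\<exists>r :: nat \<Rightarrow> real. r \<longlonglongrightarrow> 0 \<and>
            (\<forall>\<^sub>F n in sequentially.
              minimax_length (data_law M W \<eta> (noise_level \<sigma> n)) \<eta> \<alpha> \<beta>
                (self_sim_class \<gamma> 1 \<epsilon>' K l)
                (\<Union>\<gamma>'\<in>{\<gamma>\<^sub>l..\<gamma>\<^sub>u}. self_sim_class \<gamma>' 1 \<epsilon> K l)
              \<ge> ereal ((1 + r n) * C * \<epsilon> powr (- 1 / (2 * \<gamma> + 1)) *
                  ((noise_level \<sigma> n)\<^sup>2 * ln (1 / noise_level \<sigma> n)) powr (\<gamma> / (2 * \<gamma> + 1)))))"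
proof -
  obtain C\<^sub>K where C\<^sub>K: "\<And>x y. \<bar>x - y\<bar> > C\<^sub>K \<Longrightarrow> K y x = 0" using assms(2) by blast
  \<comment> \<open>The given range may be nonpositive or fractional; a positive integer C makes A =
    4 C an integer, as dyadic centres require.\<close>
  define C where "C = nat \<lceil>max C\<^sub>K 1\<rceil>"
  have C: "1 \<le> C" "C\<^sub>K \<le> real C" unfolding C_def by linarith+
  have "K 0 (\<bar>C\<^sub>K\<bar> + 1) = 0" by (rule C\<^sub>K) simp
  with assms(1) obtain V\<^sub>0 where V\<^sub>0: "\<And>v. \<bar>K 0 v\<bar> \<le> V\<^sub>0"
    using bounded_variation_line_bounded unfolding bv_kernel_def by blast
  define V where "V = max V\<^sub>0 1"
  define s where "s = 1 / (4 * V)"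
  have V: "1 \<le> V" "\<And>v. \<bar>K 0 v\<bar> \<le> V" using V\<^sub>0 by (auto simp: V_def le_max_iff_disj)
  have s: "0 < s" "s \<le> 1" "4 * s * V \<le> 1" using V(1) by (auto simp: s_def field_simps)
  \<comment> \<open>The constants are fixed before any \<gamma> is given, when
    \<open>\<gamma>\<^sub>u\<close> is not yet known to be positive.\<close>
  define \<Gamma> where "\<Gamma> = max \<gamma>\<^sub>u 1"
  define N where "N = nat \<lceil>\<Gamma>\<rceil>"
  have \<Gamma>: "\<gamma>\<^sub>u \<le> \<Gamma>" "0 < \<Gamma>" "\<Gamma> \<le> real N" by (auto simp: \<Gamma>_def N_def)
  obtain \<psi> D where \<psi>: "D \<ge> 1" "\<And>k x. k \<le> N \<Longrightarrow> \<bar>\<psi> k x\<bar> \<le> D"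
    "\<And>k x. k < N \<Longrightarrow> (\<psi> k has_real_derivative \<psi> (Suc k) x) (at x)"
    "\<And>k x. k \<le> N \<Longrightarrow> s \<le> \<bar>x\<bar> \<Longrightarrow> \<psi> k x = 0" "\<psi> 0 0 = 1" "\<And>x. 0 \<le> \<psi> 0 x" "\<And>x. \<psi> 0 x \<le> 1"
    using smooth_bump_exists[OF s(1), of N] by metis
  \<comment> \<open>Then J - 2 = 4 C + 1, and n < 2^n gives the size condition.\<close>
  define J where "J = 4 * C + 3"
  have J: "2 \<le> J" "4 * C + 1 \<le> 2 ^ (J - 2)"
    using less_exp[of "4 * C + 1"] by (auto simp: J_def intro: less_imp_le)
  interpret self_similar_construction \<psi> D s N "4 * C" C K V J
    using \<psi> s C V J C\<^sub>K assms(3) by unfold_locales (auto intro: C\<^sub>K)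
  \<comment> \<open>The three constants come from K and \<open>\<gamma>\<^sub>u\<close> alone. The
    error term is 0, since the bound holds exactly for all large n.\<close>
  show ?thesis
  proof (rule exI[of _ "rate_constant \<Gamma>"], rule conjI, rule rate_constant_pos[OF \<Gamma>(2)],
      rule exI[of _ "int J"], rule exI[of _ "amp / 2"], rule conjI, rule half_gt_zero[OF amp(1)],
      intro allI impI, elim conjE, rule exI[of _ "\<lambda>_. 0"], rule conjI, rule tendsto_const)
    fix \<gamma>\<^sub>l \<gamma> \<alpha> \<beta> :: real and l :: int and \<epsilon> \<epsilon>' \<sigma> \<eta> :: real and M :: "'a measure" and W :: "real \<Rightarrow> 'a \<Rightarrow> real"
    assume "0 < \<gamma>\<^sub>l" "\<gamma>\<^sub>l < \<gamma>" "\<gamma> \<le> \<gamma>\<^sub>u" "2 * \<alpha> < \<beta>" "l \<ge> int J" "0 < \<epsilon>" "\<epsilon> \<le> \<epsilon>'" "\<epsilon>' < amp / 2"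
      "\<sigma> > 0" "two_sided_brownian_motion M W"
    then show "\<forall>\<^sub>F n in sequentially.
        ereal ((1 + 0) * rate_constant \<Gamma> * \<epsilon> powr (- 1 / (2 * \<gamma> + 1)) *
          ((noise_level \<sigma> n)\<^sup>2 * ln (1 / noise_level \<sigma> n)) powr (\<gamma> / (2 * \<gamma> + 1)))
        \<le> minimax_length (data_law M W \<eta> (noise_level \<sigma> n)) \<eta> \<alpha> \<beta> (self_sim_class \<gamma> 1 \<epsilon>' K l)
            (\<Union>\<gamma>'\<in>{\<gamma>\<^sub>l..\<gamma>\<^sub>u}. self_sim_class \<gamma>' 1 \<epsilon> K l)"
      using \<Gamma> eventually_minimax_length_rate[of M W \<sigma> \<gamma>\<^sub>l \<gamma> \<Gamma> \<gamma>\<^sub>u \<epsilon> \<epsilon>' l \<alpha> \<beta> \<eta>]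
      by simp
  qed
qed

end
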